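(* Let $k$ be an algebraically closed field of characteristic zero and let $n\geq 2$. Let $I=(f_i;\, i\geq n)$ be the ideal of $k[y_1,y_2,\ldots]$ generated by the polynomials $f_i=D^i(y_0^n)|_{y_0=0}$, $i\geq n$. Then, with respect to the weighted reverse lexicographic ordering, the leading ideal of $I$ is $$L(I)=(\operatorname{lm}(f_i);\, i\geq n).$$
   Context: $D$ is the $k$-derivation of the polynomial ring $k[y_0,y_1,y_2,\ldots]$ (countably many variables) with $D(y_i)=y_{i+1}$ for all $i\geq 0$. The weight of $y_i$ is $i$, and the weight of a monomial $y^\alpha$ is $\operatorname{wt}\alpha=\sum_i i\,\alpha_i$. The monomial ordering is the weighted reverse lexicographic ordering: for finitely supported exponent vectors $\alpha,\beta$, $y^\alpha>y^\beta$ if and only if $\operatorname{wt}\alpha>\operatorname{wt}\beta$, or $\operatorname{wt}\alpha=\operatorname{wt}\beta$ and the last non-zero entry of $\alpha-\beta$ is negative. $k[y_1,y_2,\ldots]$ carries the induced ordering. $\operatorname{lm}(f)$ is the leading (largest) monomial of a nonzero polynomial $f$, and $L(I)$ is the ideal generated by the leading monomials of all nonzero elements of $I$. *)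

theory Defs
  imports
    "HOL-Library.Poly_Mapping"
    "HOL-Algebra.Ideal"
    "HOL-Computational_Algebra.Polynomial"
begin

text \<open>
  The polynomial ring \<open>k[y\<^sub>0, y\<^sub>1, y\<^sub>2, \<dots>]\<close>: an exponent vector is a finitely supported map
  \<^typ>\<open>nat \<Rightarrow>\<^sub>0 nat\<close>, and a polynomial is a finitely supported map from exponent vectors to
  coefficients, with the convolution product of \<^theory>\<open>HOL-Library.Poly_Mapping\<close>. The library's
  order on \<^typ>\<open>nat \<Rightarrow>\<^sub>0 nat\<close> is a different one and is not used here.
\<close>

type_synonym expvec = "nat \<Rightarrow>\<^sub>0 nat"
type_synonym 'a ypoly = "expvec \<Rightarrow>\<^sub>0 'a"

abbreviation expo :: "expvec \<Rightarrow> nat \<Rightarrow> nat"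
  where "expo \<equiv> poly_mapping.lookup"

definition Const :: "'a \<Rightarrow> 'a::comm_ring_1 ypoly"
  where "Const c = Poly_Mapping.single 0 c"

definition monom_y :: "expvec \<Rightarrow> 'a::comm_ring_1 ypoly"
  where "monom_y \<alpha> = Poly_Mapping.single \<alpha> 1"

definition Y :: "nat \<Rightarrow> 'a::comm_ring_1 ypoly"
  where "Y i = monom_y (Poly_Mapping.single i 1)"


subsection \<open>The derivation and the generators\<close>

definition k_derivation :: "('a::comm_ring_1 ypoly \<Rightarrow> 'a ypoly) \<Rightarrow> bool"
  where "k_derivation D \<longleftrightarrow>
    (\<forall>f g. D (f + g) = D f + D g) \<and>
    (\<forall>c f. D (Const c * f) = Const c * D f) \<and>
    (\<forall>f g. D (f * g) = f * D g + g * D f)"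

text \<open>Substitution of the polynomials \<open>\<sigma> i\<close> for the variables \<open>y\<^sub>i\<close>.\<close>

definition subst_y :: "(nat \<Rightarrow> 'a::comm_ring_1 ypoly) \<Rightarrow> 'a ypoly \<Rightarrow> 'a ypoly"
  where "subst_y \<sigma> f =
    (\<Sum>\<alpha>\<in>Poly_Mapping.keys f. Const (poly_mapping.lookup f \<alpha>) *
       (\<Prod>i\<in>Poly_Mapping.keys \<alpha>. \<sigma> i ^ expo \<alpha> i))"

definition y0_to_0 :: "'a::comm_ring_1 ypoly \<Rightarrow> 'a ypoly"
  where "y0_to_0 f = subst_y (\<lambda>i. if i = 0 then 0 else Y i) f"

definition jet_gen :: "('a::comm_ring_1 ypoly \<Rightarrow> 'a ypoly) \<Rightarrow> nat \<Rightarrow> nat \<Rightarrow> 'a ypoly"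
  where "jet_gen D n i = y0_to_0 ((D ^^ i) (Y 0 ^ n))"


subsection \<open>The ring \<open>k[y\<^sub>1, y\<^sub>2, \<dots>]\<close>\<close>

text \<open>
  It is the subring of those polynomials of \<open>k[y\<^sub>0, y\<^sub>1, \<dots>]\<close> in which \<open>y\<^sub>0\<close> does not occur. Ideals
  have to be taken in this subring, hence the explicit carrier.
\<close>

definition ypos_ring :: "'a::comm_ring_1 ypoly ring"
  where "ypos_ring =
    \<lparr>carrier = {f. \<forall>\<alpha>\<in>Poly_Mapping.keys f. expo \<alpha> 0 = 0},
     monoid.mult = (*), one = 1, zero = 0, add = (+)\<rparr>"


subsection \<open>The weighted reverse lexicographic ordering and leading ideals\<close>

definition wt :: "expvec \<Rightarrow> nat"
  where "wt \<alpha> = (\<Sum>i\<in>Poly_Mapping.keys \<alpha>. i * expo \<alpha> i)"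

text \<open>\<open>wrevlex_gr \<alpha> \<beta>\<close> means \<open>y\<^sup>\<alpha> > y\<^sup>\<beta>\<close>; the difference \<open>\<alpha> - \<beta>\<close> is taken in the integers.\<close>

definition wrevlex_gr :: "expvec \<Rightarrow> expvec \<Rightarrow> bool"
  where "wrevlex_gr \<alpha> \<beta> \<longleftrightarrow>
    wt \<alpha> > wt \<beta> \<or>
    wt \<alpha> = wt \<beta> \<and>
      (\<exists>i. int (expo \<alpha> i) - int (expo \<beta> i) < 0 \<and>
           (\<forall>j>i. int (expo \<alpha> j) - int (expo \<beta> j) = 0))"

text \<open>Leading exponent and leading monomial; meaningful for \<open>f \<noteq> 0\<close> only.\<close>

definition lexp :: "'a::comm_ring_1 ypoly \<Rightarrow> expvec"
  where "lexp f = (THE \<alpha>. \<alpha> \<in> Poly_Mapping.keys f \<and>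
    (\<forall>\<beta>\<in>Poly_Mapping.keys f. \<beta> \<noteq> \<alpha> \<longrightarrow> wrevlex_gr \<alpha> \<beta>))"

definition lm :: "'a::comm_ring_1 ypoly \<Rightarrow> 'a ypoly"
  where "lm f = monom_y (lexp f)"

definition leading_ideal :: "'a::comm_ring_1 ypoly set \<Rightarrow> 'a ypoly set"
  where "leading_ideal I = Idl\<^bsub>ypos_ring\<^esub> {lm f | f. f \<in> I \<and> f \<noteq> 0}"


subsection \<open>Well-definedness\<close>

lemma cring_ypos_ring: "cring (ypos_ring :: 'a::comm_ring_1 ypoly ring)"
proof (rule cringI)
  let ?S = "{f :: 'a ypoly. \<forall>\<alpha>\<in>Poly_Mapping.keys f. expo \<alpha> 0 = 0}"
  have add: "f + g \<in> ?S" if "f \<in> ?S" "g \<in> ?S" for f g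
    using that keys_add[of f g] by blast
  have mult: "f * g \<in> ?S" if "f \<in> ?S" "g \<in> ?S" for f g
    using that keys_mult[of f g] by (fastforce simp: lookup_add)
  have uminus: "- f \<in> ?S" if "f \<in> ?S" for f
    using that by (auto simp: in_keys_iff)
  have R: "carrier (ypos_ring :: 'a ypoly ring) = ?S" "\<zero>\<^bsub>ypos_ring\<^esub> = (0 :: 'a ypoly)"
    "\<one>\<^bsub>ypos_ring\<^esub> = (1 :: 'a ypoly)" "f \<oplus>\<^bsub>ypos_ring\<^esub> g = f + g" "f \<otimes>\<^bsub>ypos_ring\<^esub> g = f * g"
    for f g :: "'a ypoly"
    by (simp_all add: ypos_ring_def)
  have zero: "0 \<in> ?S" and one: "1 \<in> ?S"
    by simp_all
  show "abelian_group (ypos_ring :: 'a ypoly ring)"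
  proof (rule abelian_groupI, unfold R)
    show "\<exists>y\<in>?S. y + x = 0" if "x \<in> ?S" for x
      by (rule bexI[OF _ uminus[OF that]]) (rule add.left_inverse)
  qed (fact add zero | rule add.assoc add.commute add_0_left)+
  show "Group.comm_monoid (ypos_ring :: 'a ypoly ring)"
    by (rule comm_monoidI, unfold R) (fact mult one | rule mult.assoc mult.commute mult_1_left)+
  show "(x \<oplus>\<^bsub>ypos_ring\<^esub> y) \<otimes>\<^bsub>ypos_ring\<^esub> z = x \<otimes>\<^bsub>ypos_ring\<^esub> z \<oplus>\<^bsub>ypos_ring\<^esub> y \<otimes>\<^bsub>ypos_ring\<^esub> z"
    for x y z :: "'a ypoly"
    unfolding R by (rule distrib_right)
qed

lemma jet_gen_carrier: "jet_gen D n i \<in> carrier (ypos_ring :: 'a::comm_ring_1 ypoly ring)"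
proof -
  interpret R: cring "ypos_ring :: 'a ypoly ring"
    by (rule cring_ypos_ring)
  let ?C = "carrier (ypos_ring :: 'a ypoly ring)"
  define \<sigma> where "\<sigma> = (\<lambda>i. if i = 0 then 0 else Y i :: 'a ypoly)"
  have add: "f + g \<in> ?C" if "f \<in> ?C" "g \<in> ?C" for f g
    using R.a_closed[OF that] by (simp add: ypos_ring_def)
  have mult: "f * g \<in> ?C" if "f \<in> ?C" "g \<in> ?C" for f g
    using R.m_closed[OF that] by (simp add: ypos_ring_def)
  have zero: "0 \<in> ?C" and one: "1 \<in> ?C" and Const: "Const c \<in> ?C" for c
    by (auto simp: ypos_ring_def Const_def)
  have var: "\<sigma> j \<in> ?C" for j
    by (auto simp: \<sigma>_def ypos_ring_def Y_def monom_y_def lookup_single)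
  have pow: "\<sigma> j ^ m \<in> ?C" for j m
    by (induction m) (use one mult var in auto)
  have prod: "(\<Prod>j\<in>A. \<sigma> j ^ e j) \<in> ?C" for A and e :: "nat \<Rightarrow> nat"
    by (induction A rule: infinite_finite_induct) (use one mult pow in auto)
  have "(\<Sum>\<alpha>\<in>A. Const (c \<alpha>) * (\<Prod>j\<in>Poly_Mapping.keys \<alpha>. \<sigma> j ^ expo \<alpha> j)) \<in> ?C"
    for A and c :: "expvec \<Rightarrow> 'a"
    by (induction A rule: infinite_finite_induct) (use zero add mult prod Const in auto)
  then show ?thesis
    unfolding jet_gen_def y0_to_0_def subst_y_def \<sigma>_def .
qed

lemma wrevlex_gr_irrefl: "\<not> wrevlex_gr \<alpha> \<alpha>"
  by (simp add: wrevlex_gr_def)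

lemma wrevlex_gr_trans:
  assumes "wrevlex_gr \<alpha> \<beta>" "wrevlex_gr \<beta> \<gamma>"
  shows "wrevlex_gr \<alpha> \<gamma>"
proof (cases "wt \<alpha> = wt \<beta> \<and> wt \<beta> = wt \<gamma>")
  case True
  with assms obtain i j
    where i: "expo \<alpha> i < expo \<beta> i" "\<And>l. l > i \<Longrightarrow> expo \<alpha> l = expo \<beta> l"
      and j: "expo \<beta> j < expo \<gamma> j" "\<And>l. l > j \<Longrightarrow> expo \<beta> l = expo \<gamma> l"
    unfolding wrevlex_gr_def by auto
  have "expo \<alpha> (max i j) < expo \<gamma> (max i j)"
    using i j by (cases i j rule: linorder_cases) (auto simp: max_def)
  moreover have "expo \<alpha> l = expo \<gamma> l" if "l > max i j" for l
    using that i(2) j(2) by simp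
  ultimately show ?thesis
    using True unfolding wrevlex_gr_def by (intro disjI2 conjI exI[of _ "max i j"]) auto
next
  case False
  with assms show ?thesis
    unfolding wrevlex_gr_def by auto
qed

lemma wrevlex_gr_total:
  assumes "\<alpha> \<noteq> \<beta>"
  shows "wrevlex_gr \<alpha> \<beta> \<or> wrevlex_gr \<beta> \<alpha>"
proof -
  let ?N = "{i. expo \<alpha> i \<noteq> expo \<beta> i}"
  have "?N \<subseteq> Poly_Mapping.keys \<alpha> \<union> Poly_Mapping.keys \<beta>"
    by (auto simp: in_keys_iff)
  then have fin: "finite ?N"
    by (rule finite_subset) simp
  have ne: "?N \<noteq> {}"
    using assms by (auto simp: poly_mapping_eq_iff fun_eq_iff)
  define m where "m = Max ?N"
  have m: "expo \<alpha> m \<noteq> expo \<beta> m"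
    using Max_in[OF fin ne] by (simp add: m_def)
  have later: "expo \<alpha> j = expo \<beta> j" if "j > m" for j
    using Max_ge[OF fin, of j] that unfolding m_def by (metis (mono_tags, lifting) leD mem_Collect_eq)
  have "wt \<alpha> \<noteq> wt \<beta> \<or> expo \<alpha> m < expo \<beta> m \<or> expo \<beta> m < expo \<alpha> m"
    using m by auto
  then show ?thesis
    unfolding wrevlex_gr_def using later by (cases "wt \<alpha>" "wt \<beta>" rule: linorder_cases) auto
qed

lemma lexp_props:
  assumes "f \<noteq> 0"
  shows "lexp f \<in> Poly_Mapping.keys f"
    and "\<beta> \<in> Poly_Mapping.keys f \<Longrightarrow> \<beta> \<noteq> lexp f \<Longrightarrow> wrevlex_gr (lexp f) \<beta>"
proof -
  have max: "\<exists>\<alpha>\<in>A. \<forall>\<beta>\<in>A. \<beta> \<noteq> \<alpha> \<longrightarrow> wrevlex_gr \<alpha> \<beta>" if "finite A" "A \<noteq> {}" for A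
    using that
  proof (induction A rule: finite_ne_induct)
    case (insert x A)
    then obtain \<alpha> where \<alpha>: "\<alpha> \<in> A" "\<forall>\<beta>\<in>A. \<beta> \<noteq> \<alpha> \<longrightarrow> wrevlex_gr \<alpha> \<beta>"
      by blast
    have "x \<noteq> \<alpha>"
      using \<alpha>(1) insert.hyps by blast
    then consider "wrevlex_gr x \<alpha>" | "wrevlex_gr \<alpha> x"
      using wrevlex_gr_total by blast
    then show ?case
    proof cases
      case 1
      then have "wrevlex_gr x \<beta>" if "\<beta> \<in> A" for \<beta>
        using \<alpha>(2) that wrevlex_gr_trans[of x \<alpha> \<beta>] by (cases "\<beta> = \<alpha>") auto
      then show ?thesis
        by blast
    next
      case 2
      then show ?thesis
        using \<alpha> by blast
    qed
  qed simp
  obtain \<alpha> where \<alpha>: "\<alpha> \<in> Poly_Mapping.keys f"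
      "\<forall>\<beta>\<in>Poly_Mapping.keys f. \<beta> \<noteq> \<alpha> \<longrightarrow> wrevlex_gr \<alpha> \<beta>"
    using max[of "Poly_Mapping.keys f"] assms by auto
  have "\<exists>!\<alpha>. \<alpha> \<in> Poly_Mapping.keys f \<and>
      (\<forall>\<beta>\<in>Poly_Mapping.keys f. \<beta> \<noteq> \<alpha> \<longrightarrow> wrevlex_gr \<alpha> \<beta>)"
  proof (rule ex1I[of _ \<alpha>])
    fix \<gamma>
    assume \<gamma>: "\<gamma> \<in> Poly_Mapping.keys f \<and>
      (\<forall>\<beta>\<in>Poly_Mapping.keys f. \<beta> \<noteq> \<gamma> \<longrightarrow> wrevlex_gr \<gamma> \<beta>)"
    show "\<gamma> = \<alpha>"
      using \<alpha> \<gamma> wrevlex_gr_trans[of \<alpha> \<gamma> \<alpha>] wrevlex_gr_irrefl[of \<alpha>] by (metis (no_types))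
  qed (use \<alpha> in blast)
  from theI'[OF this]
  show "lexp f \<in> Poly_Mapping.keys f"
    and "\<beta> \<in> Poly_Mapping.keys f \<Longrightarrow> \<beta> \<noteq> lexp f \<Longrightarrow> wrevlex_gr (lexp f) \<beta>"
    unfolding lexp_def by blast+
qed

text \<open>A \<open>k\<close>-derivation with \<open>D y\<^sub>i = y\<^bsub>i+1\<^esub>\<close> exists.\<close>

lemma ex_shift_derivation:
  "\<exists>D :: 'a::comm_ring_1 ypoly \<Rightarrow> 'a ypoly. k_derivation D \<and> (\<forall>i. D (Y i) = Y (Suc i))"
proof -
  define t :: "expvec \<Rightarrow> nat \<Rightarrow> 'a ypoly" where
    "t \<alpha> i = of_nat (expo \<alpha> i) * Y (Suc i) * monom_y (\<alpha> - Poly_Mapping.single i 1)" for \<alpha> i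
  define d where "d \<alpha> = (\<Sum>i\<in>Poly_Mapping.keys \<alpha>. t \<alpha> i)" for \<alpha>
  define D where
    "D f = (\<Sum>\<alpha>\<in>Poly_Mapping.keys f. Const (poly_mapping.lookup f \<alpha>) * d \<alpha>)" for f
  have d_super: "d \<alpha> = (\<Sum>i\<in>A. t \<alpha> i)" if "finite A" "Poly_Mapping.keys \<alpha> \<subseteq> A" for \<alpha> A
    unfolding d_def by (rule sum.mono_neutral_left) (use that in \<open>auto simp: t_def in_keys_iff\<close>)
  have D_super: "D f = (\<Sum>\<alpha>\<in>A. Const (poly_mapping.lookup f \<alpha>) * d \<alpha>)"
    if "finite A" "Poly_Mapping.keys f \<subseteq> A" for f A
    unfolding D_def
    by (rule sum.mono_neutral_left) (use that in \<open>auto simp: Const_def in_keys_iff\<close>)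
  have Const_add: "Const (a + b) = Const a + Const b" for a b :: 'a
    by (simp add: Const_def single_add)
  have mon_mult: "monom_y \<alpha> * monom_y \<beta> = (monom_y (\<alpha> + \<beta>) :: 'a ypoly)" for \<alpha> \<beta>
    by (simp add: monom_y_def mult_single)
  have Const_mult: "Const a * Const b = Const (a * b)" for a b :: 'a
    by (simp add: Const_def mult_single)
  have Const_mon: "Const a * monom_y \<alpha> = Poly_Mapping.single \<alpha> a" for a :: 'a and \<alpha>
    by (simp add: Const_def monom_y_def mult_single)
  have D_add: "D (f + g) = D f + D g" for f g
  proof -
    let ?A = "Poly_Mapping.keys f \<union> Poly_Mapping.keys g"
    show ?thesis
      using D_super[of ?A f] D_super[of ?A g] D_super[of ?A "f + g"] keys_add[of f g]
      by (simp add: lookup_add Const_add distrib_right sum.distrib)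
  qed
  have D_0: "D 0 = 0"
    by (simp add: D_def)
  have D_single: "D (Poly_Mapping.single \<alpha> a) = Const a * d \<alpha>" for \<alpha> a
    using D_super[of "{\<alpha>}" "Poly_Mapping.single \<alpha> a"] by (simp add: Const_def)
  have t_left: "t \<alpha> i * monom_y \<beta> =
      of_nat (expo \<alpha> i) * Y (Suc i) * monom_y (\<alpha> + \<beta> - Poly_Mapping.single i 1)" for \<alpha> \<beta> i
  proof (cases "expo \<alpha> i = 0")
    case False
    then have "\<alpha> - Poly_Mapping.single i 1 + \<beta> = \<alpha> + \<beta> - Poly_Mapping.single i 1"
      by (intro poly_mapping_eqI) (auto simp: lookup_add lookup_minus lookup_single when_def)
    then show ?thesis
      by (simp add: t_def mult.assoc mon_mult)
  qed (simp add: t_def)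
  have t_add: "t (\<alpha> + \<beta>) i = t \<alpha> i * monom_y \<beta> + t \<beta> i * monom_y \<alpha>" for \<alpha> \<beta> i
    using t_left[of \<alpha> i \<beta>] t_left[of \<beta> i \<alpha>]
    by (simp add: t_def[of "\<alpha> + \<beta>"] lookup_add distrib_right add.commute[of \<beta> \<alpha>])
  have d_add: "d (\<alpha> + \<beta>) = d \<alpha> * monom_y \<beta> + d \<beta> * monom_y \<alpha>" for \<alpha> \<beta>
  proof -
    let ?A = "Poly_Mapping.keys \<alpha> \<union> Poly_Mapping.keys \<beta>"
    show ?thesis
      using d_super[of ?A \<alpha>] d_super[of ?A \<beta>] d_super[of ?A "\<alpha> + \<beta>"] keys_add[of \<alpha> \<beta>]
      by (simp add: t_add sum.distrib sum_distrib_right)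
  qed
  have split: "f = Poly_Mapping.single \<alpha> a + Poly_Mapping.update \<alpha> 0 f"
    if "poly_mapping.lookup f \<alpha> = a" for f :: "'a ypoly" and \<alpha> a
    using that by (intro poly_mapping_eqI) (auto simp: lookup_add lookup_update lookup_single when_def)
  have induct: "P f"
    if "P 0" and "\<And>\<alpha> a g. P g \<Longrightarrow> P (Poly_Mapping.single \<alpha> a + g)" for P and f :: "'a ypoly"
  proof (induction "card (Poly_Mapping.keys f)" arbitrary: f)
    case 0
    then show ?case using that(1) by simp
  next
    case (Suc m)
    then obtain \<alpha> where \<alpha>: "\<alpha> \<in> Poly_Mapping.keys f"
      by (metis card.empty ex_in_conv nat.distinct(1))
    have "m = card (Poly_Mapping.keys (Poly_Mapping.update \<alpha> 0 f))"
      using Suc.hyps(2) \<alpha> by (simp add: keys_update)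
    from Suc.hyps(1)[OF this] show ?case
      using that(2) split[OF refl, of f \<alpha>] by metis
  qed
  have leib1: "D (Poly_Mapping.single \<alpha> a * g) =
      Poly_Mapping.single \<alpha> a * D g + g * D (Poly_Mapping.single \<alpha> a)" for \<alpha> a g
  proof (induction g rule: induct)
    case (2 \<beta> b g)
    have "D (Poly_Mapping.single \<alpha> a * Poly_Mapping.single \<beta> b) =
      Poly_Mapping.single \<alpha> a * D (Poly_Mapping.single \<beta> b)
      + Poly_Mapping.single \<beta> b * D (Poly_Mapping.single \<alpha> a)"
      unfolding mult_single D_single d_add Const_mult[symmetric]
      unfolding Const_mon[symmetric]
      by (simp add: algebra_simps)
    with 2 show ?case
      by (simp add: distrib_left distrib_right D_add)
  qed (simp add: D_0)
  have leib: "D (f * g) = f * D g + g * D f" for f g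
    by (induction f rule: induct) (simp_all add: D_0 distrib_left distrib_right D_add leib1)
  have D_Const: "D (Const c) = 0" for c
    by (simp add: Const_def D_single) (simp add: d_def)
  have "D (Y i) = Y (Suc i)" for i
    by (simp add: Y_def monom_y_def D_single)
      (simp add: d_def t_def Const_def Y_def monom_y_def)
  with D_add leib D_Const show ?thesis
    unfolding k_derivation_def by (intro exI[of _ D]) simp
qed

end

theory Submission
  imports Defs "HOL-Library.Multiset"
begin

text \<open>
  The coefficients of \<open>D\<^sup>i(y\<^sub>0\<^sup>n)\<close> show that the leading monomials of the generators are the
  \<open>y\<^sub>q\<^bsup>n-r\<^esup> y\<^bsub>q+1\<^esub>\<^bsup>r\<^esup>\<close> with \<open>q \<ge> 1\<close>. It remains to exclude that some \<open>f \<in> I\<close> has a leading monomial \<open>y\<^sup>\<alpha>\<close>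
  divisible by none of them (call \<open>y\<^sup>\<alpha>\<close> admissible), that is, with \<open>\<alpha>\<^sub>q + \<alpha>\<^bsub>q+1\<^esub> < n\<close> for all
  \<open>q \<ge> 1\<close>. No Buchberger computation is needed: a linear functional that vanishes on \<open>I\<close>, does not vanish on \<open>y\<^sup>\<alpha>\<close> and
  vanishes on all smaller monomials gives a contradiction.

  Functionals on the part of degree \<open>m\<close> correspond to symmetric polynomials in \<open>z\<^sub>0, \<dots>, z\<^bsub>m-1\<^esub>\<close>, and
  those vanishing on \<open>I\<close> to the ones that vanish whenever \<open>n\<close> variables coincide and that are
  divisible by all \<open>z\<^sub>p\<close>. If \<open>\<lambda>\<^sub>0 \<ge> \<lambda>\<^sub>1 \<ge> \<dots>\<close> are the parts of \<open>\<alpha>\<close>, the condition on \<open>\<alpha>\<close> says that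
  \<open>\<lambda>\<^sub>p \<ge> \<lambda>\<^bsub>p+n-1\<^esub> + 2\<close>. Distribute the positions into \<open>n - 1\<close> blocks by residues modulo \<open>n - 1\<close> and
  symmetrise a monomial times \<open>\<Prod>(z\<^sub>a - z\<^sub>b)\<close>, over all pairs \<open>a < b\<close> in a common block. Two of any \<open>n\<close>
  positions share a block, so the result vanishes on \<open>I\<close>; the monomial is chosen such that \<open>z\<^sup>\<lambda>\<close> is
  the term in which the earlier variable is always taken, and all other terms belong to monomials
  greater than \<open>y\<^sup>\<alpha>\<close>.
\<close>

subsection \<open>Mixed derivatives at the origin\<close>

abbreviation unit_exp :: "nat \<Rightarrow> expvec"
  where "unit_exp j \<equiv> Poly_Mapping.single j (Suc 0)"

lemma ypoly_induct [case_names zero add]: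
  fixes f :: "'a::comm_ring_1 ypoly"
  assumes "P 0" and "\<And>\<alpha> a g. P g \<Longrightarrow> P (Poly_Mapping.single \<alpha> a + g)"
  shows "P f"
proof (induction f rule: update_induct)
  case (update g \<alpha> a)
  have "Poly_Mapping.update \<alpha> a g = Poly_Mapping.single \<alpha> a + g"
    using update by (intro poly_mapping_eqI)
      (auto simp: lookup_update lookup_add lookup_single when_def in_keys_iff)
  then show ?case
    using assms(2) update by simp
qed (rule assms)

text \<open>The operator \<open>j! \<partial>/\<partial>y\<^sub>j\<close>.\<close>

definition scaled_pd :: "nat \<Rightarrow> 'a::comm_ring_1 ypoly \<Rightarrow> 'a ypoly"
  where "scaled_pd j f = Abs_poly_mapping
    (\<lambda>\<kappa>. of_nat (fact j * Suc (expo \<kappa> j)) * poly_mapping.lookup f (\<kappa> + unit_exp j))"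

lemma lookup_scaled_pd:
  "poly_mapping.lookup (scaled_pd j f) \<kappa> =
    of_nat (fact j * Suc (expo \<kappa> j)) * poly_mapping.lookup f (\<kappa> + unit_exp j)"
proof -
  have "finite ((\<lambda>\<kappa>. \<kappa> + unit_exp j) -` Poly_Mapping.keys f)"
    by (rule finite_vimageI) (auto simp: inj_on_def)
  then have "finite {\<kappa>. of_nat (fact j * Suc (expo \<kappa> j)) *
      poly_mapping.lookup f (\<kappa> + unit_exp j) \<noteq> 0}"
    by (rule finite_subset[rotated]) (auto simp: in_keys_iff)
  then show ?thesis
    unfolding scaled_pd_def by (subst lookup_Abs_poly_mapping) auto
qed

lemma scaled_pd_add: "scaled_pd j (f + g) = scaled_pd j f + scaled_pd j g"
  by (rule poly_mapping_eqI) (simp add: lookup_scaled_pd lookup_add distrib_left)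

lemma scaled_pd_0: "scaled_pd j 0 = 0"
  by (rule poly_mapping_eqI) (simp add: lookup_scaled_pd)

text \<open>If \<open>y_j\<close> does not divide the monomial, the truncated difference
  \<open>\<alpha> - unit_exp j\<close> is the wrong exponent, but then the coefficient is
  zero.\<close>

lemma scaled_pd_single:
  "scaled_pd j (Poly_Mapping.single \<alpha> a) =
    Poly_Mapping.single (\<alpha> - unit_exp j) (of_nat (fact j * expo \<alpha> j) * a)"
proof (rule poly_mapping_eqI)
  fix \<kappa>
  show "poly_mapping.lookup (scaled_pd j (Poly_Mapping.single \<alpha> a)) \<kappa> = poly_mapping.lookup
      (Poly_Mapping.single (\<alpha> - unit_exp j) (of_nat (fact j * expo \<alpha> j) * a)) \<kappa>"
  proof (cases "expo \<alpha> j = 0")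
    case True
    then have "\<alpha> \<noteq> \<kappa> + unit_exp j"
      by (auto simp: lookup_add)
    with True show ?thesis
      by (simp add: lookup_scaled_pd lookup_single_not_eq)
  next
    case False
    then have "\<alpha> - unit_exp j + unit_exp j = \<alpha>"
      by (intro poly_mapping_eqI) (auto simp: lookup_add lookup_minus lookup_single when_def)
    then have "\<alpha> = \<kappa> + unit_exp j \<longleftrightarrow> \<alpha> - unit_exp j = \<kappa>"
      by (metis add_diff_cancel_right')
    moreover have "Suc (expo \<kappa> j) = expo \<alpha> j" if "\<alpha> - unit_exp j = \<kappa>"
      using that False by (auto simp: lookup_minus)
    ultimately show ?thesis
      unfolding lookup_scaled_pd by
        (auto simp add: lookup_single when_def simp del: mult_Suc_right of_nat_mult)
  qed
qed

lemma scaled_pd_mult: "scaled_pd j (f * g) = scaled_pd j f * g + f * scaled_pd j g"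
proof -
  have sub: "\<alpha> + \<beta> - unit_exp j = \<alpha> - unit_exp j + \<beta>" if "expo \<alpha> j \<noteq> 0" for \<alpha> \<beta> :: expvec
    using that by (intro poly_mapping_eqI) (auto simp: lookup_add lookup_minus lookup_single when_def)
  have single: "scaled_pd j (Poly_Mapping.single \<alpha> a * Poly_Mapping.single \<beta> b) =
    scaled_pd j (Poly_Mapping.single \<alpha> a) * Poly_Mapping.single \<beta> b +
    Poly_Mapping.single \<alpha> a * scaled_pd j (Poly_Mapping.single \<beta> b)" for \<alpha> \<beta> and a b :: 'a
  proof -
    have 1: "scaled_pd j (Poly_Mapping.single \<alpha> a) * Poly_Mapping.single \<beta> b =
      Poly_Mapping.single (\<alpha> + \<beta> - unit_exp j) (of_nat (fact j * expo \<alpha> j) * a * b)"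
      by (cases "expo \<alpha> j = 0") (simp_all add: scaled_pd_single mult_single sub)
    have 2: "Poly_Mapping.single \<alpha> a * scaled_pd j (Poly_Mapping.single \<beta> b) =
      Poly_Mapping.single (\<alpha> + \<beta> - unit_exp j) (of_nat (fact j * expo \<beta> j) * a * b)"
      using sub[of \<beta> \<alpha>]
      by (cases "expo \<beta> j = 0") (simp_all add: scaled_pd_single mult_single ac_simps)
    show ?thesis
      unfolding 1 2 by
        (simp add: mult_single scaled_pd_single lookup_add flip: single_add,
          simp add: algebra_simps)
  qed
  have "scaled_pd j (Poly_Mapping.single \<alpha> a * g) =
    scaled_pd j (Poly_Mapping.single \<alpha> a) * g + Poly_Mapping.single \<alpha> a * scaled_pd j g" for \<alpha> a
    by (induction g rule: ypoly_induct) (simp_all add: scaled_pd_0 scaled_pd_add single algebra_simps)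
  then show ?thesis
    by (induction f rule: ypoly_induct) (simp_all add: scaled_pd_0 scaled_pd_add algebra_simps)
qed

text \<open>Exponent vector of the product of the \<open>y_(s p)\<close>. Labelling the factors by
  positions turns the Leibniz rule into a sum over subsets of \<open>T\<close>.\<close>

definition occ :: "nat set \<Rightarrow> (nat \<Rightarrow> nat) \<Rightarrow> expvec"
  where "occ T s = (\<Sum>p\<in>T. unit_exp (s p))"

definition mfact :: "expvec \<Rightarrow> nat"
  where "mfact \<kappa> = (\<Prod>j\<in>Poly_Mapping.keys \<kappa>. fact (expo \<kappa> j))"

text \<open>The constant term of \<open>(\<Prod>p\<in>T. (s p)! \<partial>/\<partial>y\<^bsub>s p\<^esub>) f\<close>, written out in terms of a coefficient of \<open>f\<close>.\<close>

definition mderiv :: "nat set \<Rightarrow> (nat \<Rightarrow> nat) \<Rightarrow> 'a::comm_ring_1 ypoly \<Rightarrow> 'a"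
  where "mderiv T s f = of_nat ((\<Prod>p\<in>T. fact (s p)) * mfact (occ T s)) *
    poly_mapping.lookup f (occ T s)"

lemma occ_empty [simp]: "occ {} s = 0"
  by (simp add: occ_def)

lemma occ_insert: "finite T \<Longrightarrow> p \<notin> T \<Longrightarrow> occ (insert p T) s = occ T s + unit_exp (s p)"
  by (simp add: occ_def add.commute)

lemma mfact_add_unit: "mfact (\<kappa> + unit_exp j) = Suc (expo \<kappa> j) * mfact \<kappa>"
proof -
  let ?A = "insert j (Poly_Mapping.keys \<kappa>)"
  have super: "mfact \<mu> = (\<Prod>i\<in>?A. fact (expo \<mu> i))" if "Poly_Mapping.keys \<mu> \<subseteq> ?A" for \<mu>
    unfolding mfact_def by (rule prod.mono_neutral_left) (use that in \<open>auto simp: in_keys_iff\<close>)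
  have "mfact (\<kappa> + unit_exp j) = (\<Prod>i\<in>?A. fact (expo (\<kappa> + unit_exp j) i))"
    using keys_add[of \<kappa> "unit_exp j"] by (intro super) auto
  also have "\<dots> = fact (expo (\<kappa> + unit_exp j) j) *
      (\<Prod>i\<in>?A - {j}. fact (expo (\<kappa> + unit_exp j) i))"
    by (rule prod.remove) auto
  also have "(\<Prod>i\<in>?A - {j}. fact (expo (\<kappa> + unit_exp j) i)) =
      (\<Prod>i\<in>?A - {j}. fact (expo \<kappa> i) :: nat)"
    by (rule prod.cong) (auto simp: lookup_add lookup_single)
  finally have "mfact (\<kappa> + unit_exp j) =
      Suc (expo \<kappa> j) * (fact (expo \<kappa> j) * (\<Prod>i\<in>?A - {j}. fact (expo \<kappa> i)))"
    by (simp add: lookup_add algebra_simps)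
  also have "fact (expo \<kappa> j) * (\<Prod>i\<in>?A - {j}. fact (expo \<kappa> i)) = (\<Prod>i\<in>?A. fact (expo \<kappa> i))"
    by (rule prod.remove[symmetric]) auto
  also have "\<dots> = mfact \<kappa>"
    by (rule super[symmetric]) auto
  finally show ?thesis .
qed

lemma mderiv_insert:
  assumes "finite T" "p \<notin> T"
  shows "mderiv (insert p T) s f = mderiv T s (scaled_pd (s p) f)"
  unfolding mderiv_def occ_insert[OF assms] mfact_add_unit lookup_scaled_pd prod.insert[OF assms]
  by (simp add: algebra_simps)

lemma mderiv_add: "mderiv T s (f + g) = mderiv T s f + mderiv T s g"
  by (simp add: mderiv_def lookup_add distrib_left)

lemma mderiv_0: "mderiv T s 0 = 0"
  by (simp add: mderiv_def)

lemma mderiv_cong: "(\<And>p. p \<in> T \<Longrightarrow> s p = s' p) \<Longrightarrow> mderiv T s f = mderiv T s' f"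
  unfolding mderiv_def occ_def by (metis (mono_tags, lifting) prod.cong sum.cong)

lemma mderiv_empty: "mderiv {} s f = poly_mapping.lookup f 0"
  by (simp add: mderiv_def mfact_def)

text \<open>Serves both the induction for the Leibniz rule and the sign-reversing pairing of
  \<open>X\<close> with \<open>insert (a, b) X\<close>.\<close>

lemma sum_Pow_insert:
  assumes "finite A" "x \<notin> A"
  shows "(\<Sum>B\<in>Pow (insert x A). g B) = (\<Sum>B\<in>Pow A. g B + g (insert x B) :: 'a::comm_monoid_add)"
proof -
  have "inj_on (insert x) (Pow A)"
    using assms(2) by (auto simp: inj_on_def)
  then show ?thesis
    unfolding Pow_insert using assms
    by (subst sum.union_disjoint) (auto simp: sum.reindex sum.distrib)
qed

lemma lookup_mult_0: "poly_mapping.lookup (f * g :: 'a::comm_ring_1 ypoly) 0 =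
    poly_mapping.lookup f 0 * poly_mapping.lookup g 0"
proof -
  have zero: "\<alpha> + \<beta> = 0 \<longleftrightarrow> \<alpha> = 0 \<and> \<beta> = 0" for \<alpha> \<beta> :: expvec
    by (auto simp: poly_mapping_eq_iff fun_eq_iff lookup_add)
  have "poly_mapping.lookup (Poly_Mapping.single \<alpha> a * g) 0 =
    poly_mapping.lookup (Poly_Mapping.single \<alpha> a) 0 * poly_mapping.lookup g 0" for \<alpha> and a :: 'a
    by (induction g rule: ypoly_induct)
      (auto simp: lookup_add distrib_left mult_single lookup_single when_def zero)
  then show ?thesis
    by (induction f rule: ypoly_induct) (auto simp: lookup_add distrib_right)
qed

text \<open>Leibniz rule: each operator falls on one of the two factors, and \<open>S\<close>
  collects those that fall on \<open>f\<close>.\<close>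

lemma mderiv_mult:
  assumes "finite T"
  shows "mderiv T s (f * g) = (\<Sum>S\<in>Pow T. mderiv S s f * mderiv (T - S) s g)"
  using assms
proof (induction T arbitrary: f g)
  case empty
  then show ?case
    by (simp add: mderiv_empty lookup_mult_0)
next
  case (insert p T)
  have "mderiv (insert p T) s (f * g) =
    (\<Sum>S\<in>Pow T. mderiv S s (scaled_pd (s p) f) * mderiv (T - S) s g
      + mderiv S s f * mderiv (T - S) s (scaled_pd (s p) g))"
    by (simp add: mderiv_insert insert scaled_pd_mult mderiv_add sum.distrib)
  also have "\<dots> = (\<Sum>S\<in>Pow T. mderiv S s f * mderiv (insert p T - S) s g +
      mderiv (insert p S) s f * mderiv (insert p T - insert p S) s g)"
  proof (rule sum.cong[OF refl])
    fix S assume S: "S \<in> Pow T"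
    then have "finite S" "p \<notin> S" "insert p T - S = insert p (T - S)" "insert p T - insert p S = T - S"
      using insert.hyps finite_subset by auto
    then show "mderiv S s (scaled_pd (s p) f) * mderiv (T - S) s g
        + mderiv S s f * mderiv (T - S) s (scaled_pd (s p) g) =
      mderiv S s f * mderiv (insert p T - S) s g +
        mderiv (insert p S) s f * mderiv (insert p T - insert p S) s g"
      using insert.hyps by (simp add: mderiv_insert add.commute)
  qed
  also have "\<dots> = (\<Sum>S\<in>Pow (insert p T). mderiv S s f * mderiv (insert p T - S) s g)"
    by (rule sum_Pow_insert[symmetric]) (use insert in auto)
  finally show ?case .
qed

lemma monom_y_add: "monom_y (\<alpha> + \<beta>) = (monom_y \<alpha> * monom_y \<beta> :: 'a::comm_ring_1 ypoly)"
  by (simp add: monom_y_def mult_single)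

lemma monom_y_single: "monom_y (Poly_Mapping.single i e) = (Y i ^ e :: 'a::comm_ring_1 ypoly)"
proof (induction e)
  case (Suc e)
  have "Poly_Mapping.single i (Suc e) = Poly_Mapping.single i 1 + Poly_Mapping.single i e"
    by (simp flip: single_add)
  with Suc show ?case
    by (simp only: monom_y_add power_Suc Y_def)
qed (simp add: monom_y_def)

text \<open>This form of induction matches what is known about \<open>D\<close>: its values on
  constants and variables, additivity and the product rule.\<close>

lemma ypoly_ring_induct [case_names Const Y add mult]:
  fixes f :: "'a::comm_ring_1 ypoly"
  assumes Const: "\<And>c. P (Const c)" and Y: "\<And>i. P (Y i)"
    and add: "\<And>f g. P f \<Longrightarrow> P g \<Longrightarrow> P (f + g)" and mult: "\<And>f g. P f \<Longrightarrow> P g \<Longrightarrow> P (f * g)"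
  shows "P f"
proof (induction f rule: ypoly_induct)
  case zero
  then show ?case
    using Const[of 0] by (simp add: Const_def)
next
  case (add \<alpha> a g)
  have one: "P 1"
    using Const[of 1] by (simp add: Const_def)
  have "P (monom_y \<alpha>)"
  proof (induction \<alpha> rule: update_induct)
    case const
    then show ?case
      using one by (simp add: monom_y_def)
  next
    case (update \<beta> i e)
    have "Poly_Mapping.update i e \<beta> = Poly_Mapping.single i e + \<beta>"
      using update by (intro poly_mapping_eqI)
        (auto simp: lookup_update lookup_add lookup_single when_def in_keys_iff)
    moreover have "P (Y i ^ e)"
      by (induction e) (use one Y mult in auto)
    ultimately show ?case
      using mult update by (simp add: monom_y_add monom_y_single)
  qed
  then have "P (Const a * monom_y \<alpha>)"
    by (intro mult Const)
  then show ?case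
    using assms(3) add by (simp add: Const_def monom_y_def mult_single)
qed

lemma lookup_occ: "finite T \<Longrightarrow> expo (occ T s) j = card {p \<in> T. s p = j}"
  by (simp only: card_eq_sum sum.inter_filter occ_def lookup_sum lookup_single when_def One_nat_def)

lemma occ_eq_single_iff:
  assumes "finite T"
  shows "occ T s = Poly_Mapping.single j n \<longleftrightarrow> card T = n \<and> (\<forall>p\<in>T. s p = j)"
proof
  assume eq: "occ T s = Poly_Mapping.single j n"
  have "s p = j" if "p \<in> T" for p
  proof (rule ccontr)
    assume "s p \<noteq> j"
    then have "card {q \<in> T. s q = s p} = 0"
      using eq lookup_occ[OF assms, of s "s p"] by (simp add: lookup_single)
    with that assms show False
      by auto
  qed
  moreover from this have "{q \<in> T. s q = j} = T"
    by auto
  then have "card T = n"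
    using eq lookup_occ[OF assms, of s j] by simp
  ultimately show "card T = n \<and> (\<forall>p\<in>T. s p = j)"
    by blast
next
  assume "card T = n \<and> (\<forall>p\<in>T. s p = j)"
  then have "{p \<in> T. s p = i} = (if i = j then T else {})" and "card T = n" for i
    by auto
  then show "occ T s = Poly_Mapping.single j n"
    by (intro poly_mapping_eqI) (simp add: lookup_occ assms lookup_single when_def)
qed

lemma occ_singleton [simp]: "occ {p} s = unit_exp (s p)"
  by (simp add: occ_def)

lemma mderiv_Y:
  assumes "finite T"
  shows "mderiv T s (Y i) = (if \<exists>p. T = {p} \<and> s p = i then of_nat (fact i) else 0 :: 'a::comm_ring_1)"
proof -
  have iff: "occ T s = unit_exp i \<longleftrightarrow> (\<exists>p. T = {p} \<and> s p = i)"
    using occ_eq_single_iff[OF assms] by (auto simp: card_Suc_eq)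
  show ?thesis
  proof (cases "\<exists>p. T = {p} \<and> s p = i")
    case True
    then obtain p where "T = {p}" "s p = i"
      by blast
    then show ?thesis
      by (simp add: mderiv_def Y_def monom_y_def mfact_def)
  next
    case False
    then have "occ T s \<noteq> unit_exp i"
      using iff by simp
    with False show ?thesis
      by (auto simp: mderiv_def Y_def monom_y_def lookup_single when_def)
  qed
qed

lemma mderiv_Const:
  assumes "finite T"
  shows "mderiv T s (Const c) = (if T = {} then c else 0 :: 'a::comm_ring_1)"
proof -
  have "occ T s = 0 \<longleftrightarrow> T = {}"
    using occ_eq_single_iff[OF assms, of s 0 0] assms by auto
  then show ?thesis
    by (auto simp: mderiv_def Const_def lookup_single when_def mfact_def)
qed

section \<open>Mixed derivatives of \<open>D f\<close> and of the generators\<close>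

lemma k_derivation_Const:
  assumes "k_derivation D"
  shows "D (Const c) = 0"
proof -
  have "D 1 = D 1 + D 1"
    using assms unfolding k_derivation_def by (metis mult_1)
  then have "D 1 = 0"
    by simp
  moreover have "D (Const c * 1) = Const c * D 1"
    using assms unfolding k_derivation_def by blast
  ultimately show ?thesis
    by simp
qed

text \<open>The commutator of \<open>\<partial>/\<partial>y_j\<close> with \<open>D\<close> is
  \<open>\<partial>/\<partial>y_(j-1)\<close>, and \<open>D f\<close> has no constant term, so each
  operator in turn is lowered by one index. The scaling by \<open>j!\<close> produces the factor
  \<open>j\<close>, which also kills the meaningless term with \<open>s p = 0\<close>.\<close>

lemma mderiv_derivation:
  fixes D :: "'a::comm_ring_1 ypoly \<Rightarrow> 'a ypoly"
  assumes D: "k_derivation D" "\<forall>i. D (Y i) = Y (i + 1)" and "finite T"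
  shows "mderiv T s (D f) = (\<Sum>p\<in>T. of_nat (s p) * mderiv T (s(p := s p - 1)) f)"
  using assms(3)
proof (induction f arbitrary: T s rule: ypoly_ring_induct)
  case (Const c)
  then show ?case
    by (simp add: k_derivation_Const[OF D(1)] mderiv_0 mderiv_Const)
next
  case (Y i)
  show ?case
  proof (cases "\<exists>p. T = {p}")
    case True
    then obtain p where [simp]: "T = {p}"
      by blast
    have ex: "(\<exists>q. {p} = {q} \<and> t q = j) \<longleftrightarrow> t p = j" for t :: "nat \<Rightarrow> nat" and j
      by auto
    show ?thesis
      using D(2) by (cases "s p") (auto simp: mderiv_Y ex algebra_simps)
  next
    case False
    then show ?thesis
      using D(2) Y by (simp add: mderiv_Y)
  qed
next
  case (add f g)
  have "D (f + g) = D f + D g"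
    using D(1) unfolding k_derivation_def by blast
  then show ?case
    by (simp add: mderiv_add add distrib_left sum.distrib)
next
  case (mult f g)
  have D_mult: "D (f * g) = f * D g + D f * g"
    using D(1) unfolding k_derivation_def by (metis mult.commute)
  \<comment> \<open>Lowering the index at a position outside \<open>S\<close> does not affect the
    factor over \<open>S\<close>, so both factors can be written with the same modified
    \<open>s\<close>; \<open>2\<close> is the mirror image.\<close>
  have 1: "mderiv S s f * mderiv (T - S) s (D g) =
    (\<Sum>p\<in>T - S. of_nat (s p) * (mderiv S (s(p := s p - 1)) f * mderiv (T - S) (s(p := s p - 1)) g))"
    if "S \<in> Pow T" for S
  proof -
    have "mderiv S s f = mderiv S (s(p := s p - 1)) f" if "p \<in> T - S" for p
      by (rule mderiv_cong) (use that in auto)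
    then have "(\<Sum>p\<in>T - S. of_nat (s p) * (mderiv S s f * mderiv (T - S) (s(p := s p - 1)) g)) =
      (\<Sum>p\<in>T - S. of_nat (s p) * (mderiv S (s(p := s p - 1)) f * mderiv (T - S) (s(p := s p - 1)) g))"
      by (intro sum.cong) auto
    then show ?thesis
      using mult.prems
      by (subst mult(2)) (simp_all only: finite_Diff sum_distrib_left mult.left_commute)
  qed
  have 2: "mderiv S s (D f) * mderiv (T - S) s g =
    (\<Sum>p\<in>S. of_nat (s p) * (mderiv S (s(p := s p - 1)) f * mderiv (T - S) (s(p := s p - 1)) g))"
    if "S \<in> Pow T" for S
  proof -
    have "mderiv (T - S) s g = mderiv (T - S) (s(p := s p - 1)) g" if "p \<in> S" for p
      by (rule mderiv_cong) (use that in auto)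
    then have "(\<Sum>p\<in>S. of_nat (s p) * (mderiv S (s(p := s p - 1)) f * mderiv (T - S) s g)) =
      (\<Sum>p\<in>S. of_nat (s p) * (mderiv S (s(p := s p - 1)) f * mderiv (T - S) (s(p := s p - 1)) g))"
      by (intro sum.cong) auto
    moreover have "finite S"
      using that mult.prems finite_subset by blast
    ultimately show ?thesis
      by (subst mult(1)) (simp_all only: sum_distrib_right mult.assoc)
  qed
  have "mderiv T s (D (f * g)) =
      (\<Sum>S\<in>Pow T. mderiv S s f * mderiv (T - S) s (D g) + mderiv S s (D f) * mderiv (T - S) s g)"
    unfolding D_mult mderiv_add mderiv_mult[OF mult.prems] by (simp add: sum.distrib)
  also have "\<dots> = (\<Sum>S\<in>Pow T. \<Sum>p\<in>T.
      of_nat (s p) * (mderiv S (s(p := s p - 1)) f * mderiv (T - S) (s(p := s p - 1)) g))"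
  proof (rule sum.cong[OF refl])
    fix S assume S: "S \<in> Pow T"
    show "mderiv S s f * mderiv (T - S) s (D g) + mderiv S s (D f) * mderiv (T - S) s g =
      (\<Sum>p\<in>T. of_nat (s p) * (mderiv S (s(p := s p - 1)) f * mderiv (T - S) (s(p := s p - 1)) g))"
      unfolding 1[OF S] 2[OF S] using S mult.prems
      by (intro sum.subset_diff[symmetric]) auto
  qed
  also have "\<dots> = (\<Sum>p\<in>T. of_nat (s p) * mderiv T (s(p := s p - 1)) (f * g))"
    unfolding mderiv_mult[OF mult.prems] sum_distrib_left by (rule sum.swap)
  finally show ?case .
qed

text \<open>\<open>(D ^^ i) (Y 0 ^ n)\<close> is \<open>i!\<close> times the coefficient of
  \<open>t^i\<close> in the \<open>n\<close>-th power of the series with terms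
  \<open>y_j t^j / j!\<close>, and the factorials in \<open>mderiv\<close> cancel the denominators.
  What matters later is that \<open>s\<close> enters only through its sum.\<close>

lemma mderiv_jet:
  fixes D :: "'a::comm_ring_1 ypoly \<Rightarrow> 'a ypoly"
  assumes D: "k_derivation D" "\<forall>i. D (Y i) = Y (i + 1)" and T: "finite T"
  shows "mderiv T s ((D ^^ i) (Y 0 ^ n)) =
    (if card T = n \<and> (\<Sum>p\<in>T. s p) = i then of_nat (fact n * fact i) else 0)"
proof (induction i arbitrary: s)
  case 0
  have Y0: "Y 0 ^ n = (Poly_Mapping.single (Poly_Mapping.single 0 n) 1 :: 'a ypoly)"
    by (simp add: monom_y_single[symmetric]) (simp add: monom_y_def)
  show ?case
  proof (cases "card T = n \<and> (\<Sum>p\<in>T. s p) = 0")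
    case True
    then have "occ T s = Poly_Mapping.single 0 n"
      using T by (simp add: occ_eq_single_iff)
    then show ?thesis
      using True T by (cases "n = 0") (auto simp: mderiv_def Y0 mfact_def)
  next
    case False
    then have "occ T s \<noteq> Poly_Mapping.single 0 n"
      using T by (simp add: occ_eq_single_iff)
    then show ?thesis
      unfolding if_not_P[OF False] by (simp add: mderiv_def Y0 lookup_single)
  qed
next
  case (Suc i)
  \<comment> \<open>The common value after lowering any nonzero entry; the weights
    \<open>s p\<close> then add up to the missing factor \<open>Suc i\<close>.\<close>
  let ?v = "if card T = n \<and> (\<Sum>p\<in>T. s p) = Suc i then of_nat (fact n * fact i) else 0 :: 'a"
  have "of_nat (s p) * mderiv T (s(p := s p - 1)) ((D ^^ i) (Y 0 ^ n)) = of_nat (s p) * ?v"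
    if p: "p \<in> T" for p
  proof (cases "s p = 0")
    case False
    have "(\<Sum>q\<in>T. (s(p := s p - 1)) q) + 1 = (\<Sum>q\<in>T. s q)"
      using False p T by (simp add: sum.remove[of T p] cong: sum.cong_simp)
    then have "(\<Sum>q\<in>T. (s(p := s p - 1)) q) = i \<longleftrightarrow> (\<Sum>q\<in>T. s q) = Suc i"
      by linarith
    then show ?thesis
      by (simp add: Suc)
  qed simp
  then have "mderiv T s ((D ^^ Suc i) (Y 0 ^ n)) = (\<Sum>p\<in>T. of_nat (s p) * ?v)"
    by (simp add: mderiv_derivation[OF D T] cong: sum.cong)
  also have "\<dots> = of_nat (\<Sum>p\<in>T. s p) * ?v"
    by (simp add: sum_distrib_right)
  finally have eq: "mderiv T s ((D ^^ Suc i) (Y 0 ^ n)) = of_nat (\<Sum>p\<in>T. s p) * ?v" .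
  have "Suc i * (fact n * fact i) = fact n * (fact (Suc i) :: nat)"
    by (simp add: algebra_simps)
  then have fact: "of_nat (Suc i) * of_nat (fact n * fact i) = (of_nat (fact n * fact (Suc i)) :: 'a)"
    by (simp only: of_nat_mult[symmetric])
  show ?case
  proof (cases "card T = n \<and> (\<Sum>p\<in>T. s p) = Suc i")
    case True
    then have "(\<Sum>p\<in>T. s p) = Suc i" ..
    then show ?thesis
      unfolding eq if_P[OF True] using fact by (simp only:)
  next
    case False
    show ?thesis
      unfolding eq if_not_P[OF False] by (rule mult_zero_right)
  qed
qed

lemma lookup_y0_to_0:
  fixes f :: "'a::comm_ring_1 ypoly"
  shows "poly_mapping.lookup (y0_to_0 f) \<kappa> = (if expo \<kappa> 0 = 0 then poly_mapping.lookup f \<kappa> else 0)"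
proof -
  let ?\<sigma> = "\<lambda>i. if i = 0 then 0 else Y i :: 'a ypoly"
  have "(\<Prod>i\<in>Poly_Mapping.keys \<alpha>. ?\<sigma> i ^ expo \<alpha> i) = (if expo \<alpha> 0 = 0 then monom_y \<alpha> else 0)"
    for \<alpha>
  proof (cases "expo \<alpha> 0 = 0")
    case True
    have "\<alpha> = (\<Sum>i\<in>Poly_Mapping.keys \<alpha>. Poly_Mapping.single i (expo \<alpha> i))"
      by (intro poly_mapping_eqI) (auto simp: lookup_sum lookup_single when_def in_keys_iff)
    moreover have "monom_y (\<Sum>i\<in>A. Poly_Mapping.single i (expo \<alpha> i)) = (\<Prod>i\<in>A. Y i ^ expo \<alpha> i :: 'a ypoly)"
      for A
      by (induction A rule: infinite_finite_induct)
        (simp_all add: monom_y_add monom_y_single, simp_all add: monom_y_def)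
    ultimately have "monom_y \<alpha> = (\<Prod>i\<in>Poly_Mapping.keys \<alpha>. Y i ^ expo \<alpha> i :: 'a ypoly)"
      by metis
    also have "\<dots> = (\<Prod>i\<in>Poly_Mapping.keys \<alpha>. ?\<sigma> i ^ expo \<alpha> i)"
      by (rule prod.cong) (use True in \<open>auto simp: in_keys_iff\<close>)
    finally show ?thesis
      using True by simp
  next
    case False
    then show ?thesis
      by (auto simp: in_keys_iff zero_power intro!: prod_zero bexI[of _ 0])
  qed
  then have "y0_to_0 f = (\<Sum>\<alpha>\<in>Poly_Mapping.keys f.
      if expo \<alpha> 0 = 0 then Poly_Mapping.single \<alpha> (poly_mapping.lookup f \<alpha>) else 0)"
    by (auto simp: y0_to_0_def subst_y_def Const_def monom_y_def mult_single intro!: sum.cong)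
  then have "poly_mapping.lookup (y0_to_0 f) \<kappa> = (\<Sum>\<alpha>\<in>Poly_Mapping.keys f.
      poly_mapping.lookup (if expo \<alpha> 0 = 0 then Poly_Mapping.single \<alpha> (poly_mapping.lookup f \<alpha>) else 0) \<kappa>)"
    by (simp add: lookup_sum)
  also have "\<dots> = (\<Sum>\<alpha>\<in>Poly_Mapping.keys f.
      if \<alpha> = \<kappa> then (if expo \<kappa> 0 = 0 then poly_mapping.lookup f \<kappa> else 0) else 0)"
    by (rule sum.cong) (auto simp: lookup_single when_def)
  finally show ?thesis
    by (auto simp: in_keys_iff)
qed

subsection \<open>The leading monomials of the generators\<close>

text \<open>Sort the multiset in which \<open>j\<close> occurs \<open>expo \<alpha> j\<close>
  times.\<close>

lemma ex_decreasing_occ: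
  "\<exists>m s. occ {..<m} s = \<alpha> \<and> (\<forall>p q. p \<le> q \<longrightarrow> q < m \<longrightarrow> s q \<le> s p)"
proof -
  define M where "M = Abs_multiset (expo \<alpha>)"
  have "finite {j. 0 < expo \<alpha> j}"
    by (rule finite_subset[of _ "Poly_Mapping.keys \<alpha>"]) (auto simp: in_keys_iff)
  then have M: "count M = expo \<alpha>"
    by (simp add: M_def Abs_multiset_inverse)
  define xs where "xs = rev (sorted_list_of_multiset M)"
  have mset: "mset xs = M" and sorted: "sorted (rev xs)"
    by (simp_all add: xs_def)
  have "expo (occ {..<length xs} ((!) xs)) j = expo \<alpha> j" for j
  proof -
    have "expo (occ {..<length xs} ((!) xs)) j = card {p. p < length xs \<and> j = xs ! p}"
      by (simp add: lookup_occ eq_commute)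
    also have "\<dots> = count (mset xs) j"
      by (simp add: count_mset count_list_eq_length_filter length_filter_conv_card)
    finally show ?thesis
      by (simp add: mset M)
  qed
  then have "occ {..<length xs} ((!) xs) = \<alpha>"
    by (rule poly_mapping_eqI)
  moreover have "xs ! q \<le> xs ! p" if "p \<le> q" "q < length xs" for p q
    using sorted_rev_nth_mono[OF sorted that] .
  ultimately show ?thesis
    by blast
qed

lemma wt_add: "wt (\<alpha> + \<beta>) = wt \<alpha> + wt \<beta>"
proof -
  let ?A = "Poly_Mapping.keys \<alpha> \<union> Poly_Mapping.keys \<beta>"
  have super: "wt \<mu> = (\<Sum>i\<in>?A. i * expo \<mu> i)" if "Poly_Mapping.keys \<mu> \<subseteq> ?A" for \<mu>
    unfolding wt_def by (rule sum.mono_neutral_left) (use that in \<open>auto simp: in_keys_iff\<close>)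
  show ?thesis
    using super[of \<alpha>] super[of \<beta>] super[of "\<alpha> + \<beta>"] keys_add[of \<alpha> \<beta>]
    by (simp add: lookup_add distrib_left sum.distrib)
qed

lemma wt_occ: "finite T \<Longrightarrow> wt (occ T s) = (\<Sum>p\<in>T. s p)"
  by (induction T rule: finite_induct) (simp_all add: occ_insert wt_add, simp_all add: wt_def)

lemma expo_occ_0:
  assumes "finite T"
  shows "expo (occ T s) 0 = 0 \<longleftrightarrow> (\<forall>p\<in>T. s p \<noteq> 0)"
  using assms by (auto simp: lookup_occ)

lemma mderiv_jet_gen:
  fixes D :: "'a::comm_ring_1 ypoly \<Rightarrow> 'a ypoly"
  assumes "k_derivation D" "\<forall>i. D (Y i) = Y (i + 1)" "finite T" "\<And>p. p \<in> T \<Longrightarrow> s p \<noteq> 0"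
  shows "mderiv T s (jet_gen D n i) =
    (if card T = n \<and> (\<Sum>p\<in>T. s p) = i then of_nat (fact n * fact i) else 0)"
proof -
  have "expo (occ T s) 0 = 0"
    using assms(3,4) by (simp add: expo_occ_0)
  then have "mderiv T s (jet_gen D n i) = mderiv T s ((D ^^ i) (Y 0 ^ n))"
    by (simp add: mderiv_def jet_gen_def lookup_y0_to_0)
  then show ?thesis
    using mderiv_jet[OF assms(1-3)] by simp
qed

lemma mfact_pos: "mfact \<kappa> > 0"
  by (simp add: mfact_def)

text \<open>Characteristic zero enters here: the factorials do not vanish, so \<open>mderiv\<close>
  detects the support.\<close>

lemma mderiv_eq_0_iff:
  fixes f :: "'a::{idom, ring_char_0} ypoly"
  assumes "finite T"
  shows "mderiv T s f = 0 \<longleftrightarrow> occ T s \<notin> Poly_Mapping.keys f"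
proof -
  have "(\<Prod>p\<in>T. fact (s p)) * mfact (occ T s) \<noteq> 0"
    using assms mfact_pos[of "occ T s"] by simp
  then show ?thesis
    unfolding mderiv_def in_keys_iff by (simp only: mult_eq_0_iff of_nat_eq_0_iff) simp
qed

lemma occ_in_keys_jet_gen:
  fixes D :: "'a::{idom, ring_char_0} ypoly \<Rightarrow> 'a ypoly"
  assumes "k_derivation D" "\<forall>i. D (Y i) = Y (i + 1)" "finite T"
  shows "occ T s \<in> Poly_Mapping.keys (jet_gen D n i) \<longleftrightarrow>
    (\<forall>p\<in>T. s p \<noteq> 0) \<and> card T = n \<and> (\<Sum>p\<in>T. s p) = i"
proof (cases "\<forall>p\<in>T. s p \<noteq> 0")
  case True
  have "of_nat (fact n * fact i) \<noteq> (0 :: 'a)"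
    by (simp only: of_nat_eq_0_iff) simp
  then show ?thesis
    using True mderiv_eq_0_iff[OF assms(3), of s "jet_gen D n i"]
      mderiv_jet_gen[OF assms, of s n i] by (metis (no_types, lifting))
next
  case False
  then have "expo (occ T s) 0 \<noteq> 0"
    using assms(3) by (simp add: expo_occ_0)
  then show ?thesis
    using False by (auto simp: in_keys_iff jet_gen_def lookup_y0_to_0)
qed

text \<open>The support of \<open>f\<^sub>i\<close> consists of all monomials of degree \<open>n\<close> and weight \<open>i\<close> without \<open>y\<^sub>0\<close>; the
  largest one is the most balanced. The case \<open>r = n\<close> repeats \<open>r = 0\<close> for \<open>q + 1\<close>, which spares case
  distinctions later.\<close>

lemma lexp_jet_gen:
  fixes D :: "'a::{idom, ring_char_0} ypoly \<Rightarrow> 'a ypoly"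
  assumes D: "k_derivation D" "\<forall>i. D (Y i) = Y (i + 1)" and q: "q \<ge> 1" and r: "r \<le> n"
  shows "jet_gen D n (q * n + r) \<noteq> 0"
    and "lexp (jet_gen D n (q * n + r)) =
      Poly_Mapping.single q (n - r) + Poly_Mapping.single (Suc q) r"
proof -
  let ?f = "jet_gen D n (q * n + r)"
  let ?\<beta> = "Poly_Mapping.single q (n - r) + Poly_Mapping.single (Suc q) r"
  \<comment> \<open>The balanced splitting of the weight: \<open>r\<close> parts
    \<open>q + 1\<close>, all others \<open>q\<close>.\<close>
  define t where "t p = (if p < r then Suc q else q)" for p
  have "{p \<in> {..<n}. t p = Suc q} = {..<r}" "{p \<in> {..<n}. t p = q} = {r..<n}"
    "j \<noteq> q \<Longrightarrow> j \<noteq> Suc q \<Longrightarrow> {p \<in> {..<n}. t p = j} = {}" for j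
    using r by (auto simp: t_def split: if_splits)
  then have \<beta>: "occ {..<n} t = ?\<beta>"
    by (intro poly_mapping_eqI, unfold lookup_occ[OF finite_lessThan] lookup_add lookup_single)
      (auto simp: when_def)
  have "(\<Sum>p<n. t p) = (\<Sum>p<n. q + of_bool (p < r))"
    by (rule sum.cong) (auto simp: t_def)
  also have "\<dots> = q * n + r"
  proof -
    have "{p. p < n \<and> p < r} = {..<r}"
      using r by auto
    then show ?thesis
      by (simp add: sum.distrib Int_def)
  qed
  finally have sum_t: "(\<Sum>p<n. t p) = q * n + r" .
  have key: "?\<beta> \<in> Poly_Mapping.keys ?f"
    unfolding \<beta>[symmetric] occ_in_keys_jet_gen[OF D finite_lessThan]
    using sum_t q by (auto simp: t_def)
  then show nz: "?f \<noteq> 0"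
    by auto
  show "lexp ?f = ?\<beta>"
  proof (rule ccontr)
    assume neq: "lexp ?f \<noteq> ?\<beta>"
    obtain m s where s: "lexp ?f = occ {..<m} s"
      using ex_decreasing_occ[of "lexp ?f"] by metis
    have m: "m = n" and sum_s: "(\<Sum>p<n. s p) = q * n + r"
      using lexp_props(1)[OF nz] unfolding s occ_in_keys_jet_gen[OF D finite_lessThan] by auto
    let ?\<kappa> = "occ {..<n} s"
    have "wrevlex_gr ?\<kappa> ?\<beta>"
      using lexp_props(2)[OF nz key] neq unfolding s m by metis
    moreover have "wt ?\<kappa> = wt ?\<beta>"
      by (simp add: \<beta>[symmetric] wt_occ sum_s sum_t)
    ultimately obtain l where l: "expo ?\<kappa> l < expo ?\<beta> l" "\<And>j. j > l \<Longrightarrow> expo ?\<kappa> j = expo ?\<beta> j"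
      unfolding wrevlex_gr_def by auto
    \<comment> \<open>\<open>expo ?\<beta> l\<close> is positive, and \<open>?\<beta>\<close>
      involves \<open>q\<close> and \<open>q + 1\<close> only.\<close>
    then have l_cases: "l = q \<or> l = Suc q"
      by (auto simp: lookup_add lookup_single when_def split: if_splits)
    have le: "s p \<le> Suc q" if "p < n" for p
    proof (rule ccontr)
      assume gt: "\<not> s p \<le> Suc q"
      then have "expo ?\<kappa> (s p) = expo ?\<beta> (s p)"
        using l_cases by (intro l(2)) auto
      also have "\<dots> = 0"
        using gt by (auto simp: lookup_add lookup_single when_def)
      finally have "{p' \<in> {..<n}. s p' = s p} = {}"
        by (simp add: lookup_occ)
      with that show False
        by auto
    qed
    \<comment> \<open>No part exceeds \<open>q + 1\<close> and at most \<open>r\<close> parts equal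
      it, so the sum \<open>q * n + r\<close> forces \<open>c = r\<close> and all other parts to be
      \<open>q\<close>. Then \<open>?\<kappa>\<close> and \<open>?\<beta>\<close> agree at
      \<open>l = q\<close>, against the choice of \<open>l\<close>.\<close>
    define c where "c = card {p \<in> {..<n}. s p = Suc q}"
    have c_r: "c \<le> r" and c_r': "c = r \<Longrightarrow> l = q"
      using l l(2)[of "Suc q"] l_cases by (auto simp: c_def lookup_occ lookup_add lookup_single)
    have sum_bound: "(\<Sum>p<n. q + of_bool (s p = Suc q)) = q * n + c"
      by (simp add: sum.distrib c_def Int_def)
    have le': "s p \<le> q + of_bool (s p = Suc q)" if "p < n" for p
      using le[OF that] by auto
    have "(\<Sum>p<n. s p) \<le> q * n + c"
      unfolding sum_bound[symmetric] by (rule sum_mono) (use le' in auto)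
    then have "c = r"
      using c_r sum_s by simp
    have "s p = q + of_bool (s p = Suc q)" if "p < n" for p
    proof (rule ccontr)
      assume "s p \<noteq> q + of_bool (s p = Suc q)"
      then have "\<exists>p\<in>{..<n}. s p < q + of_bool (s p = Suc q)"
        using that le_neq_implies_less[OF le'[OF that]] by blast
      moreover have "\<forall>p\<in>{..<n}. s p \<le> q + of_bool (s p = Suc q)"
        using le' by blast
      ultimately have "(\<Sum>p<n. s p) < (\<Sum>p<n. q + of_bool (s p = Suc q))"
        by (intro sum_strict_mono_ex1 finite_lessThan)
      then show False
        using sum_s sum_bound \<open>c = r\<close> by simp
    qed
    then have "{p \<in> {..<n}. s p = q} = {..<n} - {p \<in> {..<n}. s p = Suc q}"
      by force
    then have "expo ?\<kappa> q = n - c"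
      by (simp add: lookup_occ c_def, subst card_Diff_subset) auto
    then show False
      using l(1) c_r'[OF \<open>c = r\<close>] \<open>c = r\<close> by (simp add: lookup_add lookup_single)
  qed
qed

subsection \<open>A functional detecting an admissible monomial\<close>

text \<open>The parts \<open>lam 0 \<ge> lam 1 \<ge> \<dots>\<close> of an admissible monomial, with \<open>d = n - 1\<close>; positions are split into
  blocks by their residue modulo \<open>d\<close>.\<close>

locale difference_two =
  fixes m d :: nat and lam :: "nat \<Rightarrow> nat"
  assumes d_pos: "d > 0"
    and decreasing: "\<And>p q. p \<le> q \<Longrightarrow> q < m \<Longrightarrow> lam q \<le> lam p"
    and lam_pos: "\<And>p. p < m \<Longrightarrow> 0 < lam p"
    and gap: "\<And>p. p + d < m \<Longrightarrow> lam (p + d) + 2 \<le> lam p"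
begin

definition pairs :: "(nat \<times> nat) set"
  where "pairs = {(a, b). a < b \<and> b < m \<and> a mod d = b mod d}"

text \<open>A set \<open>X\<close> of pairs selects the term of \<open>\<Prod>(z\<^sub>a - z\<^sub>b)\<close> in which \<open>z\<^sub>b\<close> is taken for the pairs in \<open>X\<close> and
  \<open>z\<^sub>a\<close> for the others. The exponents \<open>base\<close> are chosen such that \<open>X = {}\<close> yields \<open>lam\<close>.\<close>

definition winner :: "(nat \<times> nat) set \<Rightarrow> nat \<times> nat \<Rightarrow> nat"
  where "winner X r = (if r \<in> X then snd r else fst r)"

definition loser :: "(nat \<times> nat) set \<Rightarrow> nat \<times> nat \<Rightarrow> nat"
  where "loser X r = (if r \<in> X then fst r else snd r)"

definition wins :: "(nat \<times> nat) set \<Rightarrow> nat \<Rightarrow> nat"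
  where "wins X p = card {r \<in> pairs. winner X r = p}"

definition base :: "nat \<Rightarrow> nat"
  where "base p = lam p - wins {} p"

definition moved :: "(nat \<times> nat) set \<Rightarrow> nat \<Rightarrow> nat"
  where "moved X p = base p + wins X p"

text \<open>Expands the product of all \<open>z_p ^ base p\<close> and all \<open>z_a - z_b\<close>,
  and evaluates each monomial \<open>z^s\<close> as \<open>mderiv {..<m} s f\<close>. This value is
  unchanged when the positions are permuted, so the symmetrisation is implicit.\<close>

definition phi :: "'a::comm_ring_1 ypoly \<Rightarrow> 'a"
  where "phi f = (\<Sum>X\<in>Pow pairs. (-1) ^ card X * mderiv {..<m} (moved X) f)"

lemma finite_pairs: "finite pairs"
  by (rule finite_subset[of _ "{..<m} \<times> {..<m}"]) (auto simp: pairs_def)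

lemma wins_empty: "wins {} p = card {b. p < b \<and> b < m \<and> b mod d = p mod d}"
proof -
  have "{r \<in> pairs. winner {} r = p} = Pair p ` {b. p < b \<and> b < m \<and> b mod d = p mod d}"
    by (auto simp: pairs_def winner_def)
  then show ?thesis
    by (simp add: wins_def card_image inj_on_def)
qed

lemma congruent_gap:
  assumes "p < q" "q mod d = p mod d"
  shows "p + d \<le> q"
proof -
  have "d dvd q - p"
    using assms by (metis less_imp_le_nat mod_eq_dvd_iff_nat)
  then have "d \<le> q - p"
    using assms by (intro dvd_imp_le) auto
  then show ?thesis
    using assms by simp
qed

lemma wins_empty_step:
  assumes "p + d < m"
  shows "wins {} p = Suc (wins {} (p + d))"
proof -
  have "{b. p < b \<and> b < m \<and> b mod d = p mod d} =
    insert (p + d) {b. p + d < b \<and> b < m \<and> b mod d = (p + d) mod d}"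
    using assms d_pos congruent_gap[of p] by (force simp: le_less)
  then show ?thesis
    unfolding wins_empty by simp
qed

text \<open>Going backwards through a block, \<open>wins {}\<close> grows by one per step and
  \<open>lam\<close> by at least two. Hence the subtraction in \<open>base\<close> is never
  truncated, and \<open>base\<close> is positive, which keeps \<open>y_0\<close> out of all terms of
  \<open>phi\<close>.\<close>

lemma wins_empty_less: "p < m \<Longrightarrow> wins {} p < lam p"
proof (induction "m - p" arbitrary: p rule: less_induct)
  case less
  show ?case
  proof (cases "p + d < m")
    case True
    moreover from this have "m - (p + d) < m - p"
      using d_pos by simp
    ultimately have "wins {} (p + d) < lam (p + d)"
      using less(1) by blast
    then show ?thesis
      using wins_empty_step[OF True] gap[OF True] by simp
  next
    case False
    then have "{b. p < b \<and> b < m \<and> b mod d = p mod d} = {}"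
      using congruent_gap[of p] by force
    then show ?thesis
      using lam_pos[OF less.prems] by (simp only: wins_empty card.empty)
  qed
qed

lemma base_pos: "p < m \<Longrightarrow> 0 < base p"
  using wins_empty_less[of p] by (simp add: base_def)

lemma moved_empty: "p < m \<Longrightarrow> moved {} p = lam p"
  using wins_empty_less[of p] by (simp add: moved_def base_def)

text \<open>Along one step of a block \<open>lam\<close> drops by at least two, but
  \<open>wins {}\<close> only by one.\<close>

lemma base_less:
  assumes "p < q" "q < m" "p mod d = q mod d"
  shows "base q < base p"
proof -
  have step: "base (p + d) < base p" if "p + d < m" for p
    using wins_empty_step[OF that] gap[OF that] wins_empty_less[OF that] by (simp add: base_def)
  have "base (p + Suc k * d) < base p" if "p + Suc k * d < m" for k
    using that
  proof (induction k)
    case 0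
    then show ?case
      using step by simp
  next
    case (Suc k)
    have "p + Suc (Suc k) * d = p + Suc k * d + d"
      by simp
    with Suc step[of "p + Suc k * d"] show ?case
      by (simp add: ac_simps)
  qed
  moreover obtain k where "q = p + k * d"
    using assms by (metis less_imp_le_nat mod_eq_nat2E mult.commute)
  moreover from this have "k \<noteq> 0"
    using assms by (auto intro: ccontr)
  ultimately show ?thesis
    using assms(2) by (metis not0_implies_Suc)
qed

lemma sum_wins:
  assumes "finite S"
  shows "(\<Sum>p\<in>S. wins X p) = card {r \<in> pairs. winner X r \<in> S}"
proof -
  have "{r \<in> pairs. winner X r \<in> S} = (\<Union>p\<in>S. {r \<in> pairs. winner X r = p})"
    by auto
  then show ?thesis
    unfolding wins_def using assms finite_pairs by (subst card_UN_disjoint[symmetric]) auto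
qed

lemma winner_less: "r \<in> pairs \<Longrightarrow> winner X r < m"
  by (auto simp: pairs_def winner_def)

text \<open>Homogeneity: every pair contributes exactly one win, whatever \<open>X\<close>
  is.\<close>

lemma wt_occ_moved: "wt (occ {..<m} (moved X)) = wt (occ {..<m} lam)"
proof -
  have "{r \<in> pairs. winner X r \<in> {..<m}} = pairs" for X
    using winner_less by auto
  then have "(\<Sum>p<m. moved X p) = (\<Sum>p<m. moved {} p)"
    by (simp add: moved_def sum.distrib sum_wins)
  also have "\<dots> = (\<Sum>p<m. lam p)"
    by (rule sum.cong) (simp_all add: moved_empty)
  finally show ?thesis
    by (simp add: wt_occ)
qed

text \<open>Let \<open>p0\<close> be the first position that loses to a later one. Before \<open>p0\<close> nothing changes.
  From \<open>p0\<close> on, only the first position of each block can still reach its old part, because \<open>base\<close> decreases strictly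
  along a block; so no part exceeds \<open>lam p0\<close>, and the part \<open>lam p0\<close> occurs less often than before.\<close>

lemma moved_greater:
  assumes X: "X \<subseteq> pairs" "X \<noteq> {}"
  shows "wrevlex_gr (occ {..<m} (moved X)) (occ {..<m} lam)"
proof -
  define p0 where "p0 = (LEAST p. \<exists>b. (p, b) \<in> X)"
  have "\<exists>p b. (p, b) \<in> X"
    using X(2) by auto
  then have "\<exists>b. (p0, b) \<in> X"
    unfolding p0_def by (rule LeastI_ex)
  then obtain b0 where b0: "(p0, b0) \<in> X"
    by blast
  have first: "p0 \<le> p" if "(p, b) \<in> X" for p b
    unfolding p0_def by (rule Least_le) (use that in blast)
  have p0: "p0 < b0" "b0 < m" "p0 mod d = b0 mod d"
    using b0 X(1) by (auto simp: pairs_def)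
  have before: "moved X p = lam p" if "p < p0" for p
  proof -
    \<comment> \<open>A pair of \<open>X\<close> has both entries at or after \<open>p0\<close>, so
      it does not involve \<open>p\<close>.\<close>
    have "{r \<in> pairs. winner X r = p} = {r \<in> pairs. winner {} r = p}"
      using first that by (force simp: winner_def loser_def pairs_def)
    then show ?thesis
      using that p0 moved_empty[of p] by (simp add: moved_def wins_def)
  qed
  \<comment> \<open>The part of the block of \<open>q\<close> that starts at
    \<open>p0\<close>.\<close>
  define cls where "cls q = {c. p0 \<le> c \<and> c < m \<and> c mod d = q mod d}" for q
  have fin: "finite (cls q)" for q
    by (rule finite_subset[of _ "{..<m}"]) (auto simp: cls_def)
  have wins_le: "wins X q \<le> card (A - {q})"
    if q: "p0 \<le> q" "q < m" and A: "A \<subseteq> cls q"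
      and others: "\<And>r. r \<in> pairs \<Longrightarrow> winner X r = q \<Longrightarrow> loser X r \<in> A" for q A
  proof -
    let ?W = "{r \<in> pairs. winner X r = q}"
    have "inj_on (loser X) ?W"
      by (auto simp: inj_on_def winner_def loser_def pairs_def split: if_splits)
    moreover have "loser X ` ?W \<subseteq> A - {q}"
    proof (rule image_subsetI)
      fix r assume "r \<in> ?W"
      then have r: "r \<in> pairs" "winner X r = q"
        by simp_all
      then have "loser X r \<noteq> q"
        by (auto simp: winner_def loser_def pairs_def)
      with others[OF r] show "loser X r \<in> A - {q}"
        by simp
    qed
    moreover have "finite (A - {q})"
      using finite_subset[OF A fin] by simp
    ultimately show ?thesis
      unfolding wins_def by (rule card_inj_on_le)
  qed
  \<comment> \<open>The loser comes after \<open>q\<close>, or it is the first entry of a pair in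
    \<open>X\<close> and hence at least \<open>p0\<close>.\<close>
  have other: "loser X r \<in> cls q"
    if "p0 \<le> q" "r \<in> pairs" "winner X r = q" for q r
    using that first by (cases r) (auto simp: cls_def pairs_def winner_def loser_def split: if_splits)
  have card_cls: "card (cls q0 - {q}) = wins {} q0"
    if q: "q \<in> cls q0" and q0: "q0 \<in> cls q0" and min: "\<And>c. c \<in> cls q0 \<Longrightarrow> q0 \<le> c" for q0 q
  proof -
    have "{b. q0 < b \<and> b < m \<and> b mod d = q0 mod d} = cls q0 - {q0}"
      using q0 min by (force simp: cls_def)
    then show ?thesis
      unfolding wins_empty using q q0 fin[of q0] by (simp add: card_Diff_singleton)
  qed
  \<comment> \<open>\<open>q\<close> wins at most as often as the first position \<open>q0\<close>
    of \<open>cls q\<close> does for \<open>X = {}\<close>. If \<open>q\<close> is not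
    \<open>q0\<close>, its strictly smaller \<open>base\<close> keeps it below
    \<open>lam q0\<close>, hence below \<open>lam p0\<close>.\<close>
  have bound: "moved X q \<le> lam q \<and> (\<forall>c\<in>cls q. q \<le> c) \<or> moved X q < lam p0"
    if q: "p0 \<le> q" "q < m" for q
  proof -
    define q0 where "q0 = Min (cls q)"
    have q_cls: "q \<in> cls q"
      using q by (simp add: cls_def)
    have q0: "q0 \<in> cls q" "\<And>c. c \<in> cls q \<Longrightarrow> q0 \<le> c"
      unfolding q0_def using Min_in[OF fin] Min_le[OF fin] q_cls by blast+
    have cls_eq: "cls q0 = cls q"
      using q0(1) by (simp add: cls_def)
    have "wins X q \<le> card (cls q - {q})"
      by (rule wins_le) (use q other in auto)
    also have "\<dots> = wins {} q0"
      unfolding cls_eq[symmetric] by (rule card_cls) (use q_cls q0 cls_eq in auto)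
    finally have le: "moved X q \<le> base q + wins {} q0"
      by (simp add: moved_def)
    have q0_m: "q0 < m" "p0 \<le> q0" "q0 mod d = q mod d"
      using q0(1) by (auto simp: cls_def)
    show ?thesis
    proof (cases "q = q0")
      case True
      then show ?thesis
        using le q0(2) moved_empty[OF q0_m(1)] by (simp add: moved_def)
    next
      case False
      then have "q0 < q"
        using q0(2)[OF q_cls] by simp
      then have "moved X q < base q0 + wins {} q0"
        using base_less[OF _ q(2) q0_m(3)] le by simp
      also have "\<dots> \<le> lam p0"
        using moved_empty[OF q0_m(1)] decreasing[OF q0_m(2,1)] by (simp add: moved_def)
      finally show ?thesis
        by simp
    qed
  qed
  \<comment> \<open>\<open>p0\<close> loses to \<open>b0\<close>, so \<open>b0\<close> can be
    removed from its possible losers.\<close>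
  have strict: "moved X p0 < lam p0"
  proof -
    have p0_m: "p0 < m" and p0_cls: "p0 \<in> cls p0" and b0_cls: "b0 \<in> cls p0 - {p0}"
      using p0 by (auto simp: cls_def)
    have "wins X p0 \<le> card (cls p0 - {b0} - {p0})"
    proof (rule wins_le)
      fix r assume r: "r \<in> pairs" "winner X r = p0"
      have "loser X r \<noteq> b0"
        using r b0 p0(1) by (cases r) (auto simp: winner_def loser_def pairs_def split: if_splits)
      then show "loser X r \<in> cls p0 - {b0}"
        using other[OF _ r] by blast
    qed (use p0_m in auto)
    also have "cls p0 - {b0} - {p0} \<subset> cls p0 - {p0}"
      using b0_cls by blast
    then have "card (cls p0 - {b0} - {p0}) < card (cls p0 - {p0})"
      using fin by (intro psubset_card_mono) auto
    also have "\<dots> = wins {} p0"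
      using p0_cls by (intro card_cls) (auto simp: cls_def)
    finally show ?thesis
      using moved_empty[OF p0_m] by (simp add: moved_def)
  qed
  have le_L: "moved X q \<le> lam p0" "lam q \<le> lam p0" if "p0 \<le> q" "q < m" for q
    using bound[OF that] decreasing[OF that] by auto
  have after: "expo (occ {..<m} (moved X)) j = expo (occ {..<m} lam) j" if "j > lam p0" for j
  proof -
    have "moved X p = j \<longleftrightarrow> lam p = j" if "p < m" for p
      using before[of p] le_L[of p] that \<open>j > lam p0\<close> by (cases "p < p0") auto
    then have "{p \<in> {..<m}. moved X p = j} = {p \<in> {..<m}. lam p = j}"
      by auto
    then show ?thesis
      by (simp only: lookup_occ finite_lessThan)
  qed
  \<comment> \<open>From \<open>p0\<close> on, reaching \<open>lam p0\<close> requires the first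
    alternative of \<open>bound\<close>, which gives \<open>lam p0 \<le> lam p\<close>. The
    inclusion is proper because \<open>strict\<close> excludes \<open>p0\<close>.\<close>
  have "{p \<in> {..<m}. moved X p = lam p0} \<subset> {p \<in> {..<m}. lam p = lam p0}"
  proof (rule psubsetI)
    show "{p \<in> {..<m}. moved X p = lam p0} \<subseteq> {p \<in> {..<m}. lam p = lam p0}"
    proof
      fix p assume "p \<in> {p \<in> {..<m}. moved X p = lam p0}"
      then have p: "p < m" "moved X p = lam p0"
        by auto
      have "lam p = lam p0"
        using before[of p] bound[of p] le_L[of p] p by (cases "p < p0") auto
      with p show "p \<in> {p \<in> {..<m}. lam p = lam p0}"
        by simp
    qed
    have "p0 \<in> {p \<in> {..<m}. lam p = lam p0} - {p \<in> {..<m}. moved X p = lam p0}"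
      using strict p0 by auto
    then show "{p \<in> {..<m}. moved X p = lam p0} \<noteq> {p \<in> {..<m}. lam p = lam p0}"
      by blast
  qed
  then have "expo (occ {..<m} (moved X)) (lam p0) < expo (occ {..<m} lam) (lam p0)"
    unfolding lookup_occ[OF finite_lessThan] by (intro psubset_card_mono) auto
  then show ?thesis
    using after wt_occ_moved unfolding wrevlex_gr_def by (intro disjI2 conjI exI[of _ "lam p0"]) auto
qed

section \<open>The functional on leading terms and on the ideal\<close>

lemma phi_leading:
  fixes f :: "'a::{idom, ring_char_0} ypoly"
  assumes "f \<noteq> 0" "lexp f = occ {..<m} lam"
  shows "phi f \<noteq> 0"
proof -
  \<comment> \<open>All terms except \<open>X = {}\<close> read off coefficients at monomials above
    the leading one.\<close>
  have zero: "mderiv {..<m} (moved X) f = 0" if X: "X \<in> Pow pairs - {{}}" for X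
  proof -
    have "wrevlex_gr (occ {..<m} (moved X)) (lexp f)"
      unfolding assms(2) by (rule moved_greater) (use X in auto)
    then have "occ {..<m} (moved X) \<notin> Poly_Mapping.keys f"
      using lexp_props(2)[OF assms(1)] wrevlex_gr_irrefl wrevlex_gr_trans by metis
    then show ?thesis
      by (simp add: mderiv_eq_0_iff)
  qed
  have "phi f = (\<Sum>X\<in>{{}}. (-1) ^ card X * mderiv {..<m} (moved X) f)"
    unfolding phi_def by (rule sum.mono_neutral_right) (use finite_pairs zero in auto)
  also have "\<dots> = mderiv {..<m} lam f"
    using mderiv_cong[of "{..<m}" "moved {}" lam f] moved_empty by simp
  also have "\<dots> \<noteq> 0"
    using lexp_props(1)[OF assms(1)] assms(2) by (simp add: mderiv_eq_0_iff)
  finally show ?thesis .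
qed

lemma phi_add: "phi (f + g) = phi f + phi g"
  by (simp add: phi_def mderiv_add distrib_left sum.distrib)

lemma phi_0: "phi 0 = 0"
  by (simp add: phi_def mderiv_0)

text \<open>Some pair \<open>(a, b)\<close> of the block structure lies in \<open>S\<close>. Toggling it in \<open>X\<close> flips the sign but keeps the
  sum of the parts over \<open>S\<close> and all parts outside \<open>S\<close>, on which alone the summand depends.\<close>

lemma phi_jet_gen_mult:
  fixes D :: "'a::comm_ring_1 ypoly \<Rightarrow> 'a ypoly"
  assumes D: "k_derivation D" "\<forall>i. D (Y i) = Y (i + 1)" and n: "d < n"
  shows "phi (jet_gen D n i * g) = 0"
proof -
  let ?t = "\<lambda>S X. (-1) ^ card X * (mderiv S (moved X) (jet_gen D n i) *
      mderiv ({..<m} - S) (moved X) g)"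
  \<comment> \<open>After the Leibniz rule and an exchange of sums, the cancellation takes place for
    each fixed set \<open>S\<close> of positions that fall on the generator.\<close>
  have "(\<Sum>X\<in>Pow pairs. ?t S X) = 0" if S: "S \<in> Pow {..<m}" for S
  proof -
    have fin: "finite S"
      using S finite_subset by blast
    have mderiv_gen: "mderiv S (moved X) (jet_gen D n i) =
      (if card S = n \<and> (\<Sum>p\<in>S. moved X p) = i then of_nat (fact n * fact i) else 0)" for X
    proof (rule mderiv_jet_gen[OF D fin])
      show "moved X p \<noteq> 0" if "p \<in> S" for p
        using base_pos[of p] that S by (auto simp: moved_def)
    qed
    show ?thesis
    proof (cases "card S = n")
      case False
      then show ?thesis
        by (simp add: mderiv_gen)
    next
      case True
      \<comment> \<open>Pigeonhole: \<open>n\<close> positions, but only \<open>d < n\<close>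
        blocks.\<close>
      have "\<not> inj_on (\<lambda>p. p mod d) S"
      proof
        assume "inj_on (\<lambda>p. p mod d) S"
        then have "card S \<le> card {..<d}"
          by (rule card_inj_on_le) (use d_pos in auto)
        with True n show False
          by simp
      qed
      then obtain a b where ab: "a \<in> S" "b \<in> S" "a < b" "a mod d = b mod d"
        unfolding inj_on_def by (metis linorder_neqE_nat)
      define R where "R = pairs - {(a, b)}"
      have R: "pairs = insert (a, b) R" "(a, b) \<notin> R" "finite R"
        using ab S finite_pairs by (auto simp: R_def pairs_def)
      have "?t S X + ?t S (insert (a, b) X) = 0" if X: "X \<in> Pow R" for X
      proof -
        have X': "finite X" "(a, b) \<notin> X"
          using X R finite_subset by auto
        have winner: "winner (insert (a, b) X) r = winner X r \<or>
          r = (a, b) \<and> winner (insert (a, b) X) r = b \<and> winner X r = a" for r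
          using X'(2) by (auto simp: winner_def)
        have "{r \<in> pairs. winner (insert (a, b) X) r \<in> S} = {r \<in> pairs. winner X r \<in> S}"
          using winner ab by metis
        then have "(\<Sum>p\<in>S. moved (insert (a, b) X) p) = (\<Sum>p\<in>S. moved X p)"
          by (simp add: moved_def sum.distrib sum_wins[OF fin])
        then have 1: "mderiv S (moved (insert (a, b) X)) (jet_gen D n i) = mderiv S (moved X) (jet_gen D n i)"
          by (simp add: mderiv_gen)
        have "moved (insert (a, b) X) p = moved X p" if "p \<in> {..<m} - S" for p
        proof -
          have "{r \<in> pairs. winner (insert (a, b) X) r = p} = {r \<in> pairs. winner X r = p}"
            using winner ab that by (metis DiffD2)
          then show ?thesis
            by (simp add: moved_def wins_def)
        qed
        then have 2: "mderiv ({..<m} - S) (moved (insert (a, b) X)) g = mderiv ({..<m} - S) (moved X) g"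
          by (rule mderiv_cong)
        show ?thesis
          unfolding 1 2 using X' by simp
      qed
      then show ?thesis
        unfolding R(1) sum_Pow_insert[OF R(3,2)] by simp
    qed
  qed
  then have "(\<Sum>S\<in>Pow {..<m}. \<Sum>X\<in>Pow pairs. ?t S X) = 0"
    by simp
  then show ?thesis
    unfolding phi_def mderiv_mult[OF finite_lessThan] sum_distrib_left by (subst sum.swap)
qed

end

subsection \<open>Leading ideals\<close>

lemma ypos_ring_simps:
  "carrier ypos_ring = {f :: 'a::comm_ring_1 ypoly. \<forall>\<alpha>\<in>Poly_Mapping.keys f. expo \<alpha> 0 = 0}"
  "\<zero>\<^bsub>ypos_ring\<^esub> = (0 :: 'a ypoly)"
  "f \<oplus>\<^bsub>ypos_ring\<^esub> g = f + (g :: 'a ypoly)" "f \<otimes>\<^bsub>ypos_ring\<^esub> g = f * (g :: 'a ypoly)"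
  by (simp_all add: ypos_ring_def)

lemma monom_y_carrier: "expo \<alpha> 0 = 0 \<Longrightarrow> monom_y \<alpha> \<in> carrier ypos_ring"
  by (simp add: ypos_ring_simps monom_y_def)

lemma lexp_carrier: "f \<in> carrier ypos_ring \<Longrightarrow> f \<noteq> 0 \<Longrightarrow> expo (lexp f) 0 = 0"
  using lexp_props(1) by (auto simp: ypos_ring_simps)

text \<open>The kernel of a functional need not be an ideal; quantifying over all multipliers
  \<open>g\<close> makes it one, so that membership need only be checked on generators.\<close>

lemma ideal_annihilator:
  fixes \<phi> :: "'a::comm_ring_1 ypoly \<Rightarrow> 'a"
  assumes add: "\<And>f g. \<phi> (f + g) = \<phi> f + \<phi> g" and zero: "\<phi> 0 = 0"
  shows "ideal {f \<in> carrier ypos_ring. \<forall>g. \<phi> (f * g) = 0} ypos_ring" (is "ideal ?K ?R")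
proof -
  interpret R: cring ?R
    by (rule cring_ypos_ring)
  have mult: "x \<otimes>\<^bsub>?R\<^esub> f \<in> ?K" if "f \<in> ?K" "x \<in> carrier ?R" for f x
  proof -
    have "\<phi> (x * f * g) = \<phi> (f * (x * g))" for g
      by (simp add: ac_simps)
    then show ?thesis
      using that R.m_closed[of x f] by (simp add: ypos_ring_simps(4))
  qed
  show ?thesis
  proof (rule idealI)
    show "Ring.ring ?R"
      by (rule R.ring_axioms)
    show "subgroup ?K (add_monoid ?R)"
    proof
      fix f assume f: "f \<in> ?K"
      have "\<ominus>\<^bsub>?R\<^esub> f = (\<ominus>\<^bsub>?R\<^esub> \<one>\<^bsub>?R\<^esub>) \<otimes>\<^bsub>?R\<^esub> f"
        using f by (simp add: R.l_minus)
      moreover have "(\<ominus>\<^bsub>?R\<^esub> \<one>\<^bsub>?R\<^esub>) \<otimes>\<^bsub>?R\<^esub> f \<in> ?K"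
        by (rule mult[OF f]) simp
      ultimately show "inv\<^bsub>add_monoid ?R\<^esub> f \<in> ?K"
        by (simp only: a_inv_def)
    next
      fix f g assume "f \<in> ?K" "g \<in> ?K"
      then show "f \<otimes>\<^bsub>add_monoid ?R\<^esub> g \<in> ?K"
        using R.add.m_closed[of f g] by (simp add: ypos_ring_simps(3) distrib_right add)
    next
      show "\<one>\<^bsub>add_monoid ?R\<^esub> \<in> ?K"
        using R.zero_closed by (simp add: ypos_ring_simps(2) zero)
    qed auto
    show "x \<otimes>\<^bsub>?R\<^esub> f \<in> ?K" if "f \<in> ?K" "x \<in> carrier ?R" for f x
      by (rule mult[OF that])
    then show "f \<otimes>\<^bsub>?R\<^esub> x \<in> ?K" if "f \<in> ?K" "x \<in> carrier ?R" for f x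
      using that R.m_comm[of f x] by (metis (no_types, lifting) mem_Collect_eq)
  qed
qed

lemma lexp_jet_ideal:
  fixes D :: "'a::{idom, ring_char_0} ypoly \<Rightarrow> 'a ypoly"
  assumes D: "k_derivation D" "\<forall>i. D (Y i) = Y (i + 1)" and n: "n \<ge> 2"
    and f: "f \<in> Idl\<^bsub>ypos_ring\<^esub> {jet_gen D n i | i. i \<ge> n}" "f \<noteq> 0"
  shows "\<exists>q\<ge>1. expo (lexp f) q + expo (lexp f) (Suc q) \<ge> n"
proof (rule ccontr)
  interpret R: cring "ypos_ring :: 'a ypoly ring"
    by (rule cring_ypos_ring)
  let ?G = "{jet_gen D n i | i. i \<ge> n}"
  assume "\<not> ?thesis"
  then have small: "expo (lexp f) q + expo (lexp f) (Suc q) < n" if "q \<ge> 1" for q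
    using that by (meson not_le)
  have "?G \<subseteq> carrier ypos_ring"
    using jet_gen_carrier by blast
  then have "f \<in> carrier ypos_ring"
    using f(1) ideal.Icarr[OF R.genideal_ideal] by blast
  then have no_y0: "expo (lexp f) 0 = 0"
    using f(2) by (rule lexp_carrier)
  obtain m lam where lexp: "occ {..<m} lam = lexp f"
    and decreasing: "\<And>p q. p \<le> q \<Longrightarrow> q < m \<Longrightarrow> lam q \<le> lam p"
    using ex_decreasing_occ[of "lexp f"] by blast
  have pos: "0 < lam p" if "p < m" for p
    using no_y0 that unfolding lexp[symmetric] by (simp add: expo_occ_0)
  \<comment> \<open>Otherwise the \<open>n\<close> consecutive positions from \<open>p\<close> to
    \<open>p + (n - 1)\<close> carry only two neighbouring values, which contradicts
    \<open>small\<close>. Positivity of the parts gives the condition \<open>q \<ge> 1\<close>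
    there.\<close>
  have gap: "lam (p + (n - 1)) + 2 \<le> lam p" if p: "p + (n - 1) < m" for p
  proof (rule ccontr)
    let ?q = "lam (p + (n - 1))"
    assume "\<not> ?q + 2 \<le> lam p"
    then have "x \<in> {x \<in> {..<m}. lam x = ?q} \<union> {x \<in> {..<m}. lam x = Suc ?q}"
      if "x \<in> {p..p + (n - 1)}" for x
      using decreasing[of p x] decreasing[of x "p + (n - 1)"] that p by force
    then have "card {p..p + (n - 1)} \<le>
        card ({x \<in> {..<m}. lam x = ?q} \<union> {x \<in> {..<m}. lam x = Suc ?q})"
      by (intro card_mono subsetI) auto
    also have "\<dots> \<le> expo (lexp f) ?q + expo (lexp f) (Suc ?q)"
      unfolding lexp[symmetric] lookup_occ[OF finite_lessThan] by (rule card_Un_le)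
    also have "\<dots> < n"
      using pos[OF p] by (intro small) simp
    finally show False
      using n by simp
  qed
  interpret difference_two m "n - 1" lam
    by unfold_locales (use n decreasing pos gap in auto)
  let ?K = "{h \<in> carrier ypos_ring. \<forall>g. phi (h * g) = (0 :: 'a)}"
  have "ideal ?K ypos_ring"
    by (rule ideal_annihilator) (rule phi_add phi_0)+
  moreover have "?G \<subseteq> ?K"
    using phi_jet_gen_mult[OF D] jet_gen_carrier n by auto
  ultimately have "f \<in> ?K"
    using f(1) R.genideal_minimal[of ?K ?G] by blast
  then have "phi (f * 1) = 0"
    by blast
  then show False
    using phi_leading[OF f(2)] lexp by simp
qed

theorem lemma5p3:
  fixes D :: "'k::{alg_closed_field, field_char_0} ypoly \<Rightarrow> 'k ypoly"
    and n :: nat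
  assumes "k_derivation D"
    and "\<forall>i. D (Y i) = Y (i + 1)"
    and "n \<ge> 2"
  shows "leading_ideal (Idl\<^bsub>ypos_ring\<^esub> {jet_gen D n i | i. i \<ge> n}) =
    Idl\<^bsub>ypos_ring\<^esub> {lm (jet_gen D n i) | i. i \<ge> n}"
proof -
  interpret R: cring "ypos_ring :: 'k ypoly ring"
    by (rule cring_ypos_ring)
  let ?G = "{jet_gen D n i | i. i \<ge> n}"
  let ?I = "Idl\<^bsub>ypos_ring\<^esub> ?G"
  let ?J = "Idl\<^bsub>ypos_ring\<^esub> {lm (jet_gen D n i) | i. i \<ge> n}"
  let ?L = "{lm f | f. f \<in> ?I \<and> f \<noteq> 0}"
  have G: "?G \<subseteq> carrier ypos_ring"
    using jet_gen_carrier by blast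
  have "f \<in> carrier ypos_ring" if "f \<in> ?I" for f
    using that ideal.Icarr[OF R.genideal_ideal[OF G]] by blast
  then have L: "?L \<subseteq> carrier ypos_ring"
    using lexp_carrier by (auto simp: lm_def intro!: monom_y_carrier)
  have nz: "jet_gen D n i \<noteq> 0" if "i \<ge> n" for i
  proof -
    \<comment> \<open>Division with remainder brings every \<open>i \<ge> n\<close> into the form
      treated by \<open>lexp_jet_gen\<close>.\<close>
    have "i = i div n * n + i mod n" "i div n \<ge> 1" "i mod n \<le> n"
      using that assms(3) by (auto simp: div_greater_zero_iff Suc_le_eq intro: less_imp_le)
    then show ?thesis
      using lexp_jet_gen(1)[OF assms(1,2)] by metis
  qed
  have gens_L: "{lm (jet_gen D n i) | i. i \<ge> n} \<subseteq> ?L"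
    using nz R.genideal_self[OF G] by blast
  then have J: "ideal ?J ypos_ring" and gens_J: "{lm (jet_gen D n i) | i. i \<ge> n} \<subseteq> ?J"
    using L by (auto intro!: R.genideal_ideal R.genideal_self[THEN subsetD])
  have "?J \<subseteq> leading_ideal ?I"
    unfolding leading_ideal_def using gens_L R.genideal_self[OF L]
    by (intro R.genideal_minimal R.genideal_ideal L) blast
  moreover have "lm f \<in> ?J" if f: "f \<in> ?I" "f \<noteq> 0" for f
  proof -
    let ?\<alpha> = "lexp f"
    obtain q where q: "q \<ge> 1" "expo ?\<alpha> q + expo ?\<alpha> (Suc q) \<ge> n"
      using lexp_jet_ideal[OF assms f] by blast
    \<comment> \<open>Take as many factors \<open>y_(q+1)\<close> as \<open>?\<alpha>\<close>
      offers, up to \<open>n\<close>; by the choice of \<open>q\<close>, enough factors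
      \<open>y_q\<close> remain for the other \<open>n - r\<close>.\<close>
    define r where "r = min n (expo ?\<alpha> (Suc q))"
    let ?\<beta> = "Poly_Mapping.single q (n - r) + Poly_Mapping.single (Suc q) r"
    have "?\<beta> + (?\<alpha> - ?\<beta>) = ?\<alpha>"
      using q by (intro poly_mapping_eqI)
        (auto simp: r_def lookup_add lookup_minus lookup_single when_def)
    then have lm_f: "lm f = monom_y (?\<alpha> - ?\<beta>) \<otimes>\<^bsub>ypos_ring\<^esub> monom_y ?\<beta>"
      unfolding lm_def ypos_ring_simps by (metis monom_y_add mult.commute)
    have "q * n + r \<ge> n"
      using q(1) by (cases q) auto
    moreover have "lm (jet_gen D n (q * n + r)) = monom_y ?\<beta>"
      using lexp_jet_gen(2)[OF assms(1,2) q(1), of r n] by (simp add: lm_def r_def)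
    ultimately have "monom_y ?\<beta> \<in> ?J"
      using gens_J by (metis (mono_tags, lifting) mem_Collect_eq subsetD)
    moreover have "expo ?\<alpha> 0 = 0"
      using f ideal.Icarr[OF R.genideal_ideal[OF G]] by (intro lexp_carrier)
    ultimately show ?thesis
      unfolding lm_f by (intro ideal.I_l_closed[OF J] monom_y_carrier) (simp_all add: lookup_minus)
  qed
  then have "leading_ideal ?I \<subseteq> ?J"
    unfolding leading_ideal_def by (intro R.genideal_minimal[OF J]) blast
  ultimately show ?thesis
    by blast
qed

end
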